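(* Let $d\ge 1$ be an integer and let $f,g\in L^2(\mathbb{R}^d)$. Write $g^\vee(t) = g(-t)$. If $g^\vee = g$, then $$\mathcal{F}_\sigma\left(D_{\sqrt2}\,\mathcal{A}_g f\right) = D_{\sqrt2}\,\mathcal{A}_g f \quad\text{and}\quad \mathcal{F}_\sigma\left(D_{\frac{1}{\sqrt2}}\,\mathcal{W}_g f\right) = D_{\frac{1}{\sqrt2}}\,\mathcal{W}_g f .$$ If $-g^\vee = g$, then $$\mathcal{F}_\sigma\left(D_{\sqrt2}\,\mathcal{A}_g f\right) = -D_{\sqrt2}\,\mathcal{A}_g f \quad\text{and}\quad \mathcal{F}_\sigma\left(D_{\frac{1}{\sqrt2}}\,\mathcal{W}_g f\right) = -D_{\frac{1}{\sqrt2}}\,\mathcal{W}_g f .$$ All equalities are between elements of $L^2(\mathbb{R}^{2d})$.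
   Context: Points of phase space are $(x,\omega)\in\mathbb{R}^d\times\mathbb{R}^d=\mathbb{R}^{2d}$. For $f,g\in L^2(\mathbb{R}^d)$: Cross ambiguity function: $\mathcal{A}_g f(x,\omega) = \int_{\mathbb{R}^d} f(t+\tfrac{x}{2})\overline{g(t-\tfrac{x}{2})}e^{-2\pi i\omega\cdot t}\,dt$. Cross Wigner distribution: $\mathcal{W}_g f(x,\omega) = \int_{\mathbb{R}^d} f(x+\tfrac{t}{2})\overline{g(x-\tfrac{t}{2})}e^{-2\pi i\omega\cdot t}\,dt$. Both functions belong to $L^2(\mathbb{R}^{2d})$. Isotropic dilation of a function $F$ on $\mathbb{R}^{2d}$: $D_\alpha F(x,\omega) = F(\alpha x,\alpha\omega)$, $\alpha>0$. Symplectic Fourier transform: for $F$ in the Schwartz space $\mathcal{S}(\mathbb{R}^{2d})$, $$\mathcal{F}_\sigma F(x,\omega) = \iint_{\mathbb{R}^{2d}} F(x',\omega')\,e^{-2\pi i(\omega\cdot x' - x\cdot\omega')}\,dx'\,d\omega',$$ extended to a unitary operator on $L^2(\mathbb{R}^{2d})$ by density. *)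

theory Defs
  imports "HOL-Analysis.Analysis"
begin

text \<open>
  Elements of \<open>L\<^sup>2\<close> are represented by Lebesgue measurable functions, and equality in \<open>L\<^sup>2\<close>
  is equality almost everywhere.
\<close>

definition L2 :: "('a::euclidean_space \<Rightarrow> complex) set" where
  "L2 = {f \<in> borel_measurable lebesgue. integrable lebesgue (\<lambda>x. (norm (f x))\<^sup>2)}"

definition L2_eq :: "('a::euclidean_space \<Rightarrow> complex) \<Rightarrow> ('a \<Rightarrow> complex) \<Rightarrow> bool" where
  "L2_eq f g \<longleftrightarrow> f \<in> L2 \<and> g \<in> L2 \<and> (AE x in lebesgue. f x = g x)"

text \<open>
  The nonnegative integral is used because the Bochner integral of a non-integrable function is 0.
\<close>

definition L2_tendsto ::
  "(nat \<Rightarrow> 'a::euclidean_space \<Rightarrow> complex) \<Rightarrow> ('a \<Rightarrow> complex) \<Rightarrow> bool" where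
  "L2_tendsto F f \<longleftrightarrow>
     (\<lambda>n. \<integral>\<^sup>+ x. ennreal ((norm (F n x - f x))\<^sup>2) \<partial>lebesgue) \<longlonglongrightarrow> 0"

definition reflect :: "('a::euclidean_space \<Rightarrow> complex) \<Rightarrow> 'a \<Rightarrow> complex" where
  "reflect g = (\<lambda>t. g (- t))"

definition ambiguity ::
  "(real^'n \<Rightarrow> complex) \<Rightarrow> (real^'n \<Rightarrow> complex) \<Rightarrow> (real^'n) \<times> (real^'n) \<Rightarrow> complex" where
  "ambiguity g f = (\<lambda>(x, \<omega>). \<integral>t. f (t + x /\<^sub>R 2) * cnj (g (t - x /\<^sub>R 2)) *
     exp (- 2 * of_real pi * \<i> * of_real (\<omega> \<bullet> t)) \<partial>lebesgue)"

definition wigner ::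
  "(real^'n \<Rightarrow> complex) \<Rightarrow> (real^'n \<Rightarrow> complex) \<Rightarrow> (real^'n) \<times> (real^'n) \<Rightarrow> complex" where
  "wigner g f = (\<lambda>(x, \<omega>). \<integral>t. f (x + t /\<^sub>R 2) * cnj (g (x - t /\<^sub>R 2)) *
     exp (- 2 * of_real pi * \<i> * of_real (\<omega> \<bullet> t)) \<partial>lebesgue)"

definition dilation ::
  "real \<Rightarrow> ((real^'n) \<times> (real^'n) \<Rightarrow> complex) \<Rightarrow> (real^'n) \<times> (real^'n) \<Rightarrow> complex" where
  "dilation \<alpha> F = (\<lambda>(x, \<omega>). F (\<alpha> *\<^sub>R x, \<alpha> *\<^sub>R \<omega>))"

text \<open>
  \<open>iter_partial [b\<^sub>1, \<dots>, b\<^sub>m] \<phi>\<close> is the iterated directional derivative of \<open>\<phi>\<close> along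
  \<open>b\<^sub>m\<close>, then \<open>\<dots>\<close>, then \<open>b\<^sub>1\<close>. It is meaningful only where the Frechet derivatives involved
  exist; \<open>schwartz\<close> demands this for all lists of basis vectors, that is, that \<open>\<phi>\<close> is smooth.
\<close>

fun iter_partial :: "'a::euclidean_space list \<Rightarrow> ('a \<Rightarrow> complex) \<Rightarrow> 'a \<Rightarrow> complex" where
  "iter_partial [] \<phi> = \<phi>"
| "iter_partial (b # bs) \<phi> = (\<lambda>x. frechet_derivative (iter_partial bs \<phi>) (at x) b)"

definition schwartz :: "('a::euclidean_space \<Rightarrow> complex) set" where
  "schwartz = {\<phi>. \<forall>bs \<in> lists Basis.
     (\<forall>x. iter_partial bs \<phi> differentiable (at x)) \<and>
     (\<forall>k::nat. bounded (range (\<lambda>x. norm x ^ k *\<^sub>R iter_partial bs \<phi> x)))}"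

definition symplectic_fourier_integral ::
  "((real^'n) \<times> (real^'n) \<Rightarrow> complex) \<Rightarrow> (real^'n) \<times> (real^'n) \<Rightarrow> complex" where
  "symplectic_fourier_integral F = (\<lambda>(x, \<omega>). \<integral>(x', \<omega>'). F (x', \<omega>') *
     exp (- 2 * of_real pi * \<i> * of_real (\<omega> \<bullet> x' - x \<bullet> \<omega>')) \<partial>lebesgue)"

text \<open>
  The continuous extension of the integral from the Schwartz space to \<open>L\<^sup>2\<close>: the value at \<open>F\<close> is
  the \<open>L\<^sup>2\<close> limit of the transforms of Schwartz functions that tend to \<open>F\<close> in \<open>L\<^sup>2\<close>. This limit
  exists by density, and is unique up to null sets because the integral is isometric on the
  Schwartz space; \<open>SOME\<close> only picks a representative. For \<open>F\<close> outside \<open>L2\<close> the value is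
  meaningless.
\<close>

definition symplectic_fourier ::
  "((real^'n) \<times> (real^'n) \<Rightarrow> complex) \<Rightarrow> (real^'n) \<times> (real^'n) \<Rightarrow> complex" where
  "symplectic_fourier F = (SOME G. G \<in> L2 \<and>
     (\<exists>\<phi>. (\<forall>n. \<phi> n \<in> schwartz) \<and> L2_tendsto \<phi> F \<and>
       L2_tendsto (\<lambda>n. symplectic_fourier_integral (\<phi> n)) G))"

end

theory Submission
  imports Defs "HOL-Probability.Probability"
begin

text \<open>
  For Gaussians, Fourier inversion in the frequency variable shows that the symplectic Fourier
  transform maps \<open>dilation (sqrt 2) (ambiguity g f)\<close> to \<open>dilation (sqrt 2) (ambiguity (reflect g) f)\<close>,
  and these functions are again complex Gaussians, hence Schwartz. Linear combinations of
  Gaussians are dense in \<open>L\<^sup>2\<close>, so the identity passes to the limit because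
  \<open>(f, g) \<mapsto> ambiguity g f\<close> is \<open>L\<^sup>2\<close>-bounded. Both this bound and the uniqueness of the limit that
  defines \<open>symplectic_fourier\<close> need only the inequality half \<open>nsq (ft h) \<le> nsq h\<close> of Plancherel's
  theorem. The Wigner distribution is a dilated ambiguity function with reflected window.
\<close>

section \<open>Gaussians and the Fourier transform of integrable functions\<close>

text \<open>Why \<open>sqrt 2\<close>: after Fourier inversion in the frequency, the integrand is
  \<open>f ((x + x') / sqrt 2)\<close> times the conjugate of \<open>g ((x - x') / sqrt 2)\<close>.
  Exactly at this dilation the old and the new position variable enter with equal weight, so
  exchanging them only replaces \<open>g\<close> by its reflection; the parity of \<open>g\<close>
  then turns the transform into multiplication by 1 or -1. Hence an explicit dense family is wanted
  in which inversion, smoothness and decay can be computed. Real Gaussians of all widths serve: a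
  product of two of them is again one, which gives the slices in closed form and also feeds
  Stone-Weierstrass. The approximating windows are symmetrised, so that they have the parity of
  \<open>g\<close> exactly and the approximants are themselves eigenfunctions. The estimates are
  made for Borel representatives; ambiguity and Wigner functions do not change at any point when
  \<open>f\<close> and \<open>g\<close> are altered on null sets, so the passage to Lebesgue
  measurable functions comes last.\<close>

lemma integral_lborel_prod:
  fixes f :: "'a::euclidean_space \<Rightarrow> real \<Rightarrow> 'b::{real_normed_field, banach, second_countable_topology}"
  assumes f: "\<And>b. b \<in> Basis \<Longrightarrow> integrable lborel (f b)"
  shows integrable_lborel_prod: "integrable lborel (\<lambda>x::'a. \<Prod>b\<in>Basis. f b (x \<bullet> b))"
    and "(\<integral>x. (\<Prod>b\<in>Basis. f b ((x::'a) \<bullet> b)) \<partial>lborel) = (\<Prod>b\<in>Basis. (\<integral>x. f b x \<partial>lborel))"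
proof -
  interpret product_sigma_finite "\<lambda>_::'a. lborel :: real measure" by standard
  have m[measurable]: "b \<in> Basis \<Longrightarrow> f b \<in> borel_measurable borel" for b
    using f[of b] by (auto dest: borel_measurable_integrable)
  \<comment> \<open>By \<open>lborel_eq\<close>, \<open>lborel\<close> is the image of the product
    measure over \<open>Basis\<close> under the map that assembles a vector from its coordinates;
    this equation reads the coordinates back.\<close>
  have eq: "(\<Prod>b\<in>Basis. f b ((\<Sum>c\<in>Basis. g c *\<^sub>R c) \<bullet> b)) = (\<Prod>b\<in>Basis. f b (g b))" for g
    by (intro prod.cong) (auto simp: inner_sum_left inner_Basis if_distrib cong: if_cong)
  show "integrable lborel (\<lambda>x::'a. \<Prod>b\<in>Basis. f b (x \<bullet> b))"
    by (subst lborel_eq, subst integrable_distr_eq)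
      (auto simp: eq intro!: product_integrable_prod f)
  show "(\<integral>x. (\<Prod>b\<in>Basis. f b ((x::'a) \<bullet> b)) \<partial>lborel) = (\<Prod>b\<in>Basis. (\<integral>x. f b x \<partial>lborel))"
    by (subst lborel_eq, subst integral_distr)
      (auto simp: eq intro!: product_integral_prod f)
qed

lemma borel_measurable_cis [measurable (raw)]:
  "f \<in> borel_measurable M \<Longrightarrow> (\<lambda>x. cis (f x)) \<in> borel_measurable M"
  unfolding cis_conv_exp by measurable

lemma borel_measurable_cnj [measurable (raw)]:
  "f \<in> borel_measurable M \<Longrightarrow> (\<lambda>x. cnj (f x)) \<in> borel_measurable M"
  by (rule measurable_compose[where N=borel])
    (auto intro!: borel_measurable_continuous_onI continuous_intros)

text \<open>The value is read off from the characteristic function of the standard normal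
  distribution: the substitution \<open>x = sqrt (2 * a) * t\<close> changes
  \<open>exp (- x\<^sup>2 / 2)\<close> into \<open>exp (- a * t\<^sup>2)\<close>, and the frequency
  \<open>y\<close> corresponds to \<open>y / sqrt (2 * a)\<close>.\<close>

lemma gaussian_real:
  fixes a y :: real
  assumes a: "a > 0"
  shows "integrable lborel (\<lambda>t. complex_of_real (exp (- a * t\<^sup>2)) * cis (y * t))"
    and "(\<integral>t. complex_of_real (exp (- a * t\<^sup>2)) * cis (y * t) \<partial>lborel)
         = complex_of_real (sqrt (pi / a) * exp (- y\<^sup>2 / (4 * a)))"
proof -
  let ?c = "sqrt (2 * a)" and ?u = "y / sqrt (2 * a)"
  have c: "?c \<noteq> 0" "?c > 0" using a by auto
  let ?f = "\<lambda>x. complex_of_real (std_normal_density x) * cis (?u * x)"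
  have "integrable lborel std_normal_density" by simp
  then have "integrable lborel ?f"
    by (rule Bochner_Integration.integrable_bound) (auto simp: norm_mult)
  then have i: "integrable lborel (\<lambda>t. ?f (0 + ?c * t))"
    using c by (intro lborel_integrable_real_affine)
  have eq: "?f (0 + ?c * t) = complex_of_real (1 / sqrt (2 * pi)) *
      (complex_of_real (exp (- a * t\<^sup>2)) * cis (y * t))" for t
    using a by (simp add: std_normal_density_def power_mult_distrib)
  have "complex_of_real (exp (- a * t\<^sup>2)) * cis (y * t) = complex_of_real (sqrt (2 * pi)) * ?f (0 + ?c * t)" for t
    unfolding eq by (simp add: field_simps)
  then show "integrable lborel (\<lambda>t. complex_of_real (exp (- a * t\<^sup>2)) * cis (y * t))"
    using Bochner_Integration.integrable_mult_right[OF i, of "complex_of_real (sqrt (2 * pi))"]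
    by (simp only:)
  have "complex_of_real (exp (- (?u^2) / 2)) = char std_normal_distribution ?u"
    by (simp add: char_std_normal_distribution)
  also have "\<dots> = (\<integral>x. ?f x \<partial>lborel)"
    unfolding char_def
    by (subst integral_density) (auto simp: cis_conv_exp scaleR_conv_of_real)
  also have "\<dots> = ?c *\<^sub>R (\<integral>t. ?f (0 + ?c * t) \<partial>lborel)"
    using lborel_integral_real_affine[OF c(1), of ?f 0] c by simp
  also have "\<dots> = ?c / sqrt (2 * pi) * (\<integral>t. complex_of_real (exp (- a * t\<^sup>2)) * cis (y * t) \<partial>lborel)"
    unfolding eq by (simp add: scaleR_conv_of_real)
  finally have "(\<integral>t. complex_of_real (exp (- a * t\<^sup>2)) * cis (y * t) \<partial>lborel)
     = of_real (sqrt (2 * pi) / ?c) * complex_of_real (exp (- (?u^2) / 2))"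
    using c by (simp add: field_simps)
  also have "sqrt (2 * pi) / ?c = sqrt (pi / a)"
    using a by (simp add: real_sqrt_mult real_sqrt_divide)
  also have "- (?u^2) / 2 = - y\<^sup>2 / (4 * a)"
    using a by (simp add: power_divide)
  finally show "(\<integral>t. complex_of_real (exp (- a * t\<^sup>2)) * cis (y * t) \<partial>lborel)
         = complex_of_real (sqrt (pi / a) * exp (- y\<^sup>2 / (4 * a)))" by simp
qed

lemma prod_cis: "finite A \<Longrightarrow> (\<Prod>a\<in>A. cis (f a)) = cis (\<Sum>a\<in>A. f a)"
  by (induction A rule: finite_induct) (auto simp: cis_mult)

lemma gaussian_cis_prod:
  fixes t \<xi> :: "'a::euclidean_space"
  shows "complex_of_real (exp (- a * (norm t)\<^sup>2)) * cis (\<xi> \<bullet> t)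
    = (\<Prod>b\<in>Basis. complex_of_real (exp (- a * (t \<bullet> b)\<^sup>2)) * cis ((\<xi> \<bullet> b) * (t \<bullet> b)))"
proof -
  have n: "(norm t)\<^sup>2 = (\<Sum>b\<in>Basis. (t \<bullet> b)\<^sup>2)"
    by (subst power2_norm_eq_inner, subst euclidean_inner) (simp add: power2_eq_square)
  show ?thesis
    by (subst euclidean_inner)
      (simp add: prod.distrib prod_cis n sum_distrib_left flip: exp_sum of_real_prod sum_negf)
qed

lemma gaussian_integral:
  fixes \<xi> :: "'a::euclidean_space"
  assumes a: "a > 0"
  shows gaussian_integrable:
      "integrable lborel (\<lambda>t. complex_of_real (exp (- a * (norm t)\<^sup>2)) * cis (\<xi> \<bullet> t))"
    and "(\<integral>t. complex_of_real (exp (- a * (norm t)\<^sup>2)) * cis (\<xi> \<bullet> t) \<partial>lborel)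
         = complex_of_real (sqrt (pi / a) ^ DIM('a) * exp (- (norm \<xi>)\<^sup>2 / (4 * a)))"
proof -
  show "integrable lborel (\<lambda>t. complex_of_real (exp (- a * (norm t)\<^sup>2)) * cis (\<xi> \<bullet> t))"
    unfolding gaussian_cis_prod
    by (rule integrable_lborel_prod
          [where f="\<lambda>b r. complex_of_real (exp (- a * r\<^sup>2)) * cis ((\<xi> \<bullet> b) * r)"])
      (intro gaussian_real a)
  have n: "(norm \<xi>)\<^sup>2 = (\<Sum>b\<in>Basis. (\<xi> \<bullet> b)\<^sup>2)"
    by (subst power2_norm_eq_inner, subst euclidean_inner) (simp add: power2_eq_square)
  have "(\<integral>t. complex_of_real (exp (- a * (norm t)\<^sup>2)) * cis (\<xi> \<bullet> t) \<partial>lborel)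
      = (\<Prod>b\<in>Basis. complex_of_real (sqrt (pi / a) * exp (- (\<xi> \<bullet> b)\<^sup>2 / (4 * a))))"
    unfolding gaussian_cis_prod
    by (subst integral_lborel_prod(2)
          [where f="\<lambda>b r. complex_of_real (exp (- a * r\<^sup>2)) * cis ((\<xi> \<bullet> b) * r)"])
      (simp_all only: gaussian_real[OF a])
  also have "\<dots> = complex_of_real (sqrt (pi / a) ^ DIM('a) * exp (- (norm \<xi>)\<^sup>2 / (4 * a)))"
    by (simp add: prod.distrib n sum_divide_distrib flip: exp_sum of_real_prod sum_negf)
  finally show "(\<integral>t. complex_of_real (exp (- a * (norm t)\<^sup>2)) * cis (\<xi> \<bullet> t) \<partial>lborel)
         = complex_of_real (sqrt (pi / a) ^ DIM('a) * exp (- (norm \<xi>)\<^sup>2 / (4 * a)))" .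
qed

text \<open>The squared L2 norm. It is valued in \<open>ennreal\<close>, so that infinite norms and
  Tonelli fit into one chain of inequalities, and taken over \<open>lborel\<close>, so that changes
  of variables and product measures apply.\<close>

definition nsq :: "('a::euclidean_space \<Rightarrow> complex) \<Rightarrow> ennreal" where
  "nsq f = (\<integral>\<^sup>+ x. ennreal ((norm (f x))\<^sup>2) \<partial>lborel)"

text \<open>For a non-integrable \<open>h\<close> the Bochner integral makes this the zero function;
  that is a default value, not the L2 Fourier transform.\<close>

definition ft :: "('a::euclidean_space \<Rightarrow> complex) \<Rightarrow> 'a \<Rightarrow> complex" where
  "ft h = (\<lambda>\<omega>. \<integral>t. h t * cis (- (2 * pi) * (\<omega> \<bullet> t)) \<partial>lborel)"

lemma borel_measurable_ft [measurable]:
  fixes h :: "'a::euclidean_space \<Rightarrow> complex"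
  assumes [measurable]: "h \<in> borel_measurable borel"
  shows "ft h \<in> borel_measurable borel"
  unfolding ft_def by measurable

lemma nn_integral_lborel_affine:
  fixes f :: "'a::euclidean_space \<Rightarrow> ennreal"
  assumes [measurable]: "f \<in> borel_measurable borel" and c: "c \<noteq> 0"
  shows "(\<integral>\<^sup>+x. f x \<partial>lborel) = ennreal (\<bar>c\<bar> ^ DIM('a)) * (\<integral>\<^sup>+x. f (t + c *\<^sub>R x) \<partial>lborel)"
  by (subst lborel_affine[OF c, of t])
    (simp add: nn_integral_density nn_integral_distr nn_integral_cmult)

lemma nn_integral_lborel_translate:
  fixes f :: "'a::euclidean_space \<Rightarrow> ennreal"
  assumes [measurable]: "f \<in> borel_measurable borel"
  shows "(\<integral>\<^sup>+x. f (t + x) \<partial>lborel) = (\<integral>\<^sup>+x. f x \<partial>lborel)"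
    and "(\<integral>\<^sup>+x. f (x + t) \<partial>lborel) = (\<integral>\<^sup>+x. f x \<partial>lborel)"
    and "(\<integral>\<^sup>+x. f (x - t) \<partial>lborel) = (\<integral>\<^sup>+x. f x \<partial>lborel)"
    and "(\<integral>\<^sup>+x. f (t - x) \<partial>lborel) = (\<integral>\<^sup>+x. f x \<partial>lborel)"
  using nn_integral_lborel_affine[of f 1 t] nn_integral_lborel_affine[of f 1 "-t"]
    nn_integral_lborel_affine[of f "-1" t]
  by (simp_all add: add.commute)

lemma ennreal_norm_integral_le:
  fixes f :: "'a \<Rightarrow> 'b::{banach, second_countable_topology}"
  shows "ennreal (norm (integral\<^sup>L M f)) \<le> (\<integral>\<^sup>+x. ennreal (norm (f x)) \<partial>M)"
  by (cases "integrable M f") (auto simp: integral_norm_bound_ennreal not_integrable_integral_eq)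

lemma integrable_lborel_tensor:
  fixes f :: "'a::euclidean_space \<Rightarrow> real" and g :: "'b::euclidean_space \<Rightarrow> real"
    and F :: "'a \<times> 'b \<Rightarrow> 'c::{banach, second_countable_topology}"
  assumes f: "integrable lborel f" and g: "integrable lborel g"
    and [measurable]: "F \<in> borel_measurable (lborel \<Otimes>\<^sub>M lborel)"
    and F: "\<And>x y. norm (F (x, y)) \<le> f x * g y"
  shows "integrable (lborel \<Otimes>\<^sub>M lborel) F"
proof (rule integrableI_bounded)
  have [measurable]: "f \<in> borel_measurable borel" "g \<in> borel_measurable borel"
    using f g by (auto dest: borel_measurable_integrable)
  have "(\<integral>\<^sup>+ z. ennreal (norm (F z)) \<partial>(lborel \<Otimes>\<^sub>M lborel))
      \<le> (\<integral>\<^sup>+ x. \<integral>\<^sup>+ y. ennreal (norm (f x)) * ennreal (norm (g y)) \<partial>lborel \<partial>lborel)"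
    by (subst lborel.nn_integral_fst[symmetric])
      (auto simp: ennreal_mult[symmetric] abs_mult[symmetric] intro!: nn_integral_mono ennreal_leI
        order_trans[OF F])
  also have "\<dots> = (\<integral>\<^sup>+ x. ennreal (norm (f x)) \<partial>lborel) * (\<integral>\<^sup>+ y. ennreal (norm (g y)) \<partial>lborel)"
    by (simp add: nn_integral_cmult nn_integral_multc)
  also have "\<dots> < \<infinity>"
    using f g by (simp add: integrable_iff_bounded ennreal_mult_less_top)
  finally show "(\<integral>\<^sup>+ z. ennreal (norm (F z)) \<partial>(lborel \<Otimes>\<^sub>M lborel)) < \<infinity>" .
qed measurable

lemma gaussian_integrable_real:
  "a > 0 \<Longrightarrow> integrable lborel (\<lambda>t::'a::euclidean_space. exp (- a * (norm t)\<^sup>2))"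
  using integrable_norm[OF gaussian_integrable[of a "0::'a"]] by (simp add: norm_mult)

lemma gaussian_fourier:
  fixes s :: "'a::euclidean_space"
  assumes a: "a > 0"
  shows "ft (\<lambda>t. complex_of_real (exp (- a * (norm t)\<^sup>2))) s
         = complex_of_real (sqrt (pi / a) ^ DIM('a) * exp (- pi\<^sup>2 * (norm s)\<^sup>2 / a))"
  using gaussian_integral(2)[OF a, of "- (2 * pi) *\<^sub>R s"]
  by (simp add: ft_def power_mult_distrib)

text \<open>The integrand is the Fourier transform of \<open>exp (- e * (norm x)\<^sup>2)\<close>.
  Its total mass 1 is the source of the constant 1 in \<open>nsq_ft_gaussian_le\<close>.\<close>

lemma gaussian_nn_integral:
  assumes e: "e > 0"
  shows "(\<integral>\<^sup>+ u. ennreal (sqrt (pi / e) ^ DIM('a) * exp (- pi\<^sup>2 * (norm (u::'a::euclidean_space))\<^sup>2 / e)) \<partial>lborel) = 1"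
proof -
  have p: "pi\<^sup>2 / e > 0" using e by simp
  have eq: "- pi\<^sup>2 * (norm u)\<^sup>2 / e = - (pi\<^sup>2 / e) * (norm u)\<^sup>2" for u :: 'a by simp
  have "complex_of_real (\<integral>u. exp (- (pi\<^sup>2 / e) * (norm (u::'a))\<^sup>2) \<partial>lborel)
      = complex_of_real (sqrt (pi / (pi\<^sup>2 / e)) ^ DIM('a))"
    using gaussian_integral(2)[OF p, of "0::'a"] by simp
  then have "(\<integral>u. exp (- (pi\<^sup>2 / e) * (norm (u::'a))\<^sup>2) \<partial>lborel) = sqrt (pi / (pi\<^sup>2 / e)) ^ DIM('a)"
    unfolding of_real_eq_iff .
  moreover have "sqrt (pi / e) * sqrt (pi / (pi\<^sup>2 / e)) = 1"
    using e by (simp add: real_sqrt_mult[symmetric] power2_eq_square)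
  ultimately have "(\<integral>u. sqrt (pi / e) ^ DIM('a) * exp (- (pi\<^sup>2 / e) * (norm (u::'a))\<^sup>2) \<partial>lborel) = 1"
    by (simp add: power_mult_distrib[symmetric])
  then show ?thesis
    unfolding eq using gaussian_integrable_real[OF p, where 'a='a] e
    by (subst nn_integral_eq_integral) auto
qed

section \<open>Contractivity of the Fourier transform in the L2 norm\<close>

lemma norm_ft_le:
  "norm (ft h \<omega>) \<le> (\<integral>t. norm (h t) \<partial>lborel)"
  unfolding ft_def by (rule order_trans[OF integral_norm_bound]) (simp add: norm_mult)

text \<open>
  Weighting with a Gaussian \<open>E\<close> makes Fubini applicable and turns \<open>\<bar>ft h\<bar>\<^sup>2\<close> into a convolution
  form \<open>\<integral>\<integral> h s * cnj (h t) * k (s - t)\<close> with a probability density \<open>k\<close>;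
  Schur's test bounds it by \<open>nsq h\<close>.
\<close>

lemma nsq_ft_gaussian_le:
  fixes h :: "'a::euclidean_space \<Rightarrow> complex"
  assumes h: "integrable lborel h" and e: "e > 0"
  shows "(\<integral>\<^sup>+ \<omega>. ennreal (exp (- e * (norm \<omega>)\<^sup>2) * (norm (ft h \<omega>))\<^sup>2) \<partial>lborel) \<le> nsq h"
proof -
  have [measurable]: "h \<in> borel_measurable borel"
    using h by (auto dest: borel_measurable_integrable)
  define E where "E \<omega> = exp (- e * (norm \<omega>)\<^sup>2)" for \<omega> :: 'a
  define B where "B = (\<integral>t. norm (h t) \<partial>lborel)"
  define k where "k u = sqrt (pi / e) ^ DIM('a) * exp (- pi\<^sup>2 * (norm u)\<^sup>2 / e)" for u :: 'a
  have [measurable]: "E \<in> borel_measurable borel" "k \<in> borel_measurable borel"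
    unfolding E_def k_def by measurable
  have E0: "E \<omega> \<ge> 0" for \<omega> by (simp add: E_def)
  have k0: "k u \<ge> 0" for u using e by (simp add: k_def)
  have HB: "norm (ft h \<omega>) \<le> B" for \<omega> unfolding B_def by (rule norm_ft_le)
  have Ei: "integrable lborel E" unfolding E_def by (rule gaussian_integrable_real[OF e])
  have hi: "integrable lborel (\<lambda>t. norm (h t))" using h by simp
  have k1: "(\<integral>\<^sup>+ u. ennreal (k u) \<partial>lborel) = 1" unfolding k_def by (rule gaussian_nn_integral[OF e])
  have Ek: "(\<integral>\<omega>. E \<omega> * cis (- (2 * pi) * (u \<bullet> \<omega>)) \<partial>lborel) = k u" for u :: 'a
    using gaussian_fourier[OF e, of u] by (simp add: ft_def E_def k_def)
  define J where "J s = (\<integral>\<omega>. E \<omega> * cis (- (2 * pi) * (\<omega> \<bullet> s)) * cnj (ft h \<omega>) \<partial>lborel)" for s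
  have J: "J s = (\<integral>t. cnj (h t) * k (s - t) \<partial>lborel)" for s
  proof -
    have "J s = (\<integral>\<omega>. (\<integral>t. E \<omega> * cis (- (2 * pi) * (\<omega> \<bullet> s)) * (cnj (h t) * cis (2 * pi * (\<omega> \<bullet> t))) \<partial>lborel) \<partial>lborel)"
      unfolding J_def ft_def by (simp flip: Bochner_Integration.integral_cnj add: cis_cnj)
    also have "\<dots> = (\<integral>t. (\<integral>\<omega>. E \<omega> * cis (- (2 * pi) * (\<omega> \<bullet> s)) * (cnj (h t) * cis (2 * pi * (\<omega> \<bullet> t))) \<partial>lborel) \<partial>lborel)"
      by (intro lborel_pair.Fubini_integral[symmetric] integrable_lborel_tensor[OF Ei hi])
        (measurable, auto simp: norm_mult E0)
    also have "\<dots> = (\<integral>t. cnj (h t) * (\<integral>\<omega>. E \<omega> * cis (- (2 * pi) * ((s - t) \<bullet> \<omega>)) \<partial>lborel) \<partial>lborel)"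
      by (intro Bochner_Integration.integral_cong refl)
        (auto simp: cis_mult inner_diff_left inner_commute algebra_simps
          simp flip: integral_mult_right_zero intro!: Bochner_Integration.integral_cong)
    finally show ?thesis unfolding Ek .
  qed
  have "complex_of_real (\<integral>\<omega>. E \<omega> * (norm (ft h \<omega>))\<^sup>2 \<partial>lborel) = (\<integral>\<omega>. E \<omega> * (ft h \<omega> * cnj (ft h \<omega>)) \<partial>lborel)"
    by (simp flip: integral_complex_of_real complex_norm_square)
  \<comment> \<open>Only one of the two factors \<open>ft h\<close> is opened. The other stays
    closed and is bounded by the constant \<open>B\<close>, so that the integrand is dominated by a
    product of an integrable function of \<open>\<omega>\<close> and one of
    \<open>s\<close>.\<close>
  also have "\<dots> = (\<integral>\<omega>. (\<integral>s. E \<omega> * (h s * cis (- (2 * pi) * (\<omega> \<bullet> s))) * cnj (ft h \<omega>) \<partial>lborel) \<partial>lborel)"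
    by (simp add: ft_def[of h] mult.assoc flip: integral_mult_right_zero integral_mult_left_zero)
  also have "\<dots> = (\<integral>s. (\<integral>\<omega>. E \<omega> * (h s * cis (- (2 * pi) * (\<omega> \<bullet> s))) * cnj (ft h \<omega>) \<partial>lborel) \<partial>lborel)"
  proof (intro lborel_pair.Fubini_integral[symmetric]
      integrable_lborel_tensor[where f="\<lambda>\<omega>. B * E \<omega>" and g="\<lambda>t. norm (h t)"])
    show "norm (case (\<omega>, s) of (\<omega>, s) \<Rightarrow> E \<omega> * (h s * cis (- (2 * pi) * (\<omega> \<bullet> s))) * cnj (ft h \<omega>))
        \<le> B * E \<omega> * norm (h s)" for \<omega> s
      using mult_right_mono[OF HB[of \<omega>], of "E \<omega> * norm (h s)"] E0
      by (simp add: norm_mult mult.commute mult.left_commute)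
  qed (use Ei hi in auto)
  also have "\<dots> = (\<integral>s. h s * J s \<partial>lborel)"
    unfolding J_def
    by (intro Bochner_Integration.integral_cong refl)
      (simp add: mult.commute mult.left_commute flip: integral_mult_right_zero)
  finally have I: "complex_of_real (\<integral>\<omega>. E \<omega> * (norm (ft h \<omega>))\<^sup>2 \<partial>lborel) = (\<integral>s. h s * J s \<partial>lborel)" .
  have int: "integrable lborel (\<lambda>\<omega>. E \<omega> * (norm (ft h \<omega>))\<^sup>2)"
  proof (rule Bochner_Integration.integrable_bound)
    show "integrable lborel (\<lambda>\<omega>. E \<omega> * B\<^sup>2)" using Ei by simp
    show "AE \<omega> in lborel. norm (E \<omega> * (norm (ft h \<omega>))\<^sup>2) \<le> norm (E \<omega> * B\<^sup>2)"
      using HB E0 by (auto intro!: AE_I2 mult_left_mono power_mono)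
  qed measurable
  have "(\<integral>\<^sup>+ \<omega>. ennreal (E \<omega> * (norm (ft h \<omega>))\<^sup>2) \<partial>lborel) = ennreal (norm (\<integral>s. h s * J s \<partial>lborel))"
    unfolding I[symmetric] using int E0 by (subst nn_integral_eq_integral) auto
  also have "\<dots> \<le> (\<integral>\<^sup>+ s. ennreal (norm (h s)) * ennreal (norm (J s)) \<partial>lborel)"
    by (rule order_trans[OF ennreal_norm_integral_le]) (simp add: norm_mult ennreal_mult)
  also have "\<dots> \<le> (\<integral>\<^sup>+ s. ennreal (norm (h s)) * (\<integral>\<^sup>+ t. ennreal (norm (h t) * k (s - t)) \<partial>lborel) \<partial>lborel)"
    unfolding J
    by (intro nn_integral_mono mult_left_mono order_trans[OF ennreal_norm_integral_le])
      (auto simp: norm_mult k0)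
  also have "\<dots> = (\<integral>\<^sup>+ s. \<integral>\<^sup>+ t. ennreal (norm (h s) * norm (h t) * k (s - t)) \<partial>lborel \<partial>lborel)"
    by (simp add: ennreal_mult' k0 mult.assoc flip: nn_integral_cmult)
  \<comment> \<open>The arithmetic-geometric mean inequality separates \<open>h s\<close> from
    \<open>h t\<close>. In each term the free variable integrates \<open>k\<close> to 1, which
    leaves half of \<open>nsq h\<close> twice.\<close>
  also have "\<dots> \<le> (\<integral>\<^sup>+ s. \<integral>\<^sup>+ t. ennreal ((norm (h s))\<^sup>2 / 2) * ennreal (k (s - t))
      + ennreal ((norm (h t))\<^sup>2 / 2) * ennreal (k (s - t)) \<partial>lborel \<partial>lborel)"
  proof (intro nn_integral_mono)
    fix s t
    have "norm (h s) * norm (h t) \<le> (norm (h s))\<^sup>2 / 2 + (norm (h t))\<^sup>2 / 2"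
      using sum_squares_bound[of "norm (h s)" "norm (h t)"] by simp
    from mult_right_mono[OF this k0[of "s - t"]]
    show "ennreal (norm (h s) * norm (h t) * k (s - t)) \<le> ennreal ((norm (h s))\<^sup>2 / 2) * ennreal (k (s - t))
      + ennreal ((norm (h t))\<^sup>2 / 2) * ennreal (k (s - t))"
      by (simp add: k0 distrib_right flip: ennreal_mult' ennreal_plus)
  qed
  also have "\<dots> = (\<integral>\<^sup>+ s. ennreal ((norm (h s))\<^sup>2 / 2) * (\<integral>\<^sup>+ t. ennreal (k (s - t)) \<partial>lborel) \<partial>lborel)
      + (\<integral>\<^sup>+ s. \<integral>\<^sup>+ t. ennreal ((norm (h t))\<^sup>2 / 2) * ennreal (k (s - t)) \<partial>lborel \<partial>lborel)"
    by (simp add: nn_integral_add nn_integral_cmult)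
  also have "(\<integral>\<^sup>+ s. \<integral>\<^sup>+ t. ennreal ((norm (h t))\<^sup>2 / 2) * ennreal (k (s - t)) \<partial>lborel \<partial>lborel)
      = (\<integral>\<^sup>+ t. \<integral>\<^sup>+ s. ennreal ((norm (h t))\<^sup>2 / 2) * ennreal (k (s - t)) \<partial>lborel \<partial>lborel)"
    by (intro lborel_pair.Fubini') measurable
  also have "\<dots> = (\<integral>\<^sup>+ t. ennreal ((norm (h t))\<^sup>2 / 2) * (\<integral>\<^sup>+ s. ennreal (k (s - t)) \<partial>lborel) \<partial>lborel)"
    by (simp add: nn_integral_cmult)
  also have "(\<lambda>s. \<integral>\<^sup>+ t. ennreal (k (s - t)) \<partial>lborel) = (\<lambda>_. 1)"
    using nn_integral_lborel_translate(4)[of "\<lambda>u. ennreal (k u)"] k1 by simp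
  also have "(\<lambda>t. \<integral>\<^sup>+ s. ennreal (k (s - t)) \<partial>lborel) = (\<lambda>_. 1)"
    using nn_integral_lborel_translate(3)[of "\<lambda>u. ennreal (k u)"] k1 by simp
  also have "(\<integral>\<^sup>+ s. ennreal ((norm (h s))\<^sup>2 / 2) * 1 \<partial>lborel) + (\<integral>\<^sup>+ t. ennreal ((norm (h t))\<^sup>2 / 2) * 1 \<partial>lborel)
      = nsq h"
    by (simp add: nsq_def flip: nn_integral_add ennreal_plus)
  finally show ?thesis unfolding E_def .
qed

text \<open>Fatou's lemma removes the Gaussian weight of \<open>nsq_ft_gaussian_le\<close> along
  \<open>e = inverse (real (Suc n))\<close>. In the non-integrable case the left side is 0 by the
  default value of \<open>ft\<close>.\<close>

theorem nsq_ft_le: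
  fixes h :: "'a::euclidean_space \<Rightarrow> complex"
  assumes [measurable]: "h \<in> borel_measurable borel"
  shows "nsq (ft h) \<le> nsq h"
proof (cases "integrable lborel h")
  case False
  have "\<not> integrable lborel (\<lambda>t. h t * cis (- (2 * pi) * (\<omega> \<bullet> t)))" for \<omega>
    using False integrable_norm_iff[of h lborel]
      integrable_norm_iff[of "\<lambda>t. h t * cis (- (2 * pi) * (\<omega> \<bullet> t))" lborel]
    by (simp add: norm_mult)
  then have "ft h = (\<lambda>_. 0)"
    unfolding ft_def by (auto simp: not_integrable_integral_eq)
  then show ?thesis by (simp add: nsq_def)
next
  case True
  let ?F = "\<lambda>n \<omega>. ennreal (exp (- inverse (real (Suc n)) * (norm \<omega>)\<^sup>2) * (norm (ft h \<omega>))\<^sup>2)"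
  have lim: "(\<lambda>n. ?F n \<omega>) \<longlonglongrightarrow> ennreal ((norm (ft h \<omega>))\<^sup>2)" for \<omega>
  proof -
    have "(\<lambda>n. exp (- inverse (real (Suc n)) * (norm \<omega>)\<^sup>2) * (norm (ft h \<omega>))\<^sup>2)
        \<longlonglongrightarrow> exp (- 0 * (norm \<omega>)\<^sup>2) * (norm (ft h \<omega>))\<^sup>2"
      by (intro tendsto_intros LIMSEQ_inverse_real_of_nat)
    then show ?thesis by (intro tendsto_ennrealI) simp
  qed
  have "nsq (ft h) = (\<integral>\<^sup>+ \<omega>. liminf (\<lambda>n. ?F n \<omega>) \<partial>lborel)"
    unfolding nsq_def by (intro nn_integral_cong lim_imp_Liminf[symmetric] lim) simp
  also have "\<dots> \<le> liminf (\<lambda>n. \<integral>\<^sup>+ \<omega>. ?F n \<omega> \<partial>lborel)"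
    by (intro nn_integral_liminf) measurable
  also have "\<dots> \<le> nsq h"
    by (intro Liminf_le always_eventually allI nsq_ft_gaussian_le[OF True]) auto
  finally show ?thesis .
qed

section \<open>The symplectic Fourier transform\<close>

lemma borel_imp_lebesgue_measurable:
  "f \<in> borel_measurable borel \<Longrightarrow> f \<in> borel_measurable lebesgue"
  by (auto intro: measurable_completion)

lemma nsq_lebesgue: "nsq f = (\<integral>\<^sup>+ x. ennreal ((norm (f x))\<^sup>2) \<partial>lebesgue)"
  by (simp add: nsq_def nn_integral_completion)

lemma L2_tendsto_iff_nsq: "L2_tendsto F f \<longleftrightarrow> (\<lambda>n. nsq (\<lambda>x. F n x - f x)) \<longlonglongrightarrow> 0"
  by (simp add: L2_tendsto_def nsq_lebesgue)

lemma L2_iff_nsq: "f \<in> L2 \<longleftrightarrow> f \<in> borel_measurable lebesgue \<and> nsq f < \<infinity>"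
  by (auto simp: L2_def nsq_lebesgue integrable_iff_bounded)

lemma nsq_cmult: "nsq (\<lambda>x. c * f x) = ennreal ((norm c)\<^sup>2) * nsq f" if "f \<in> borel_measurable lebesgue"
proof -
  have [measurable]: "f \<in> borel_measurable lebesgue" by fact
  show ?thesis
    by (simp add: nsq_lebesgue norm_mult power_mult_distrib ennreal_mult nn_integral_cmult)
qed

lemma nsq_minus_commute: "nsq (\<lambda>x. f x - g x) = nsq (\<lambda>x. g x - f x)"
  by (simp add: nsq_def norm_minus_commute)

text \<open>From \<open>(a + b)\<^sup>2 \<le> 2 * a\<^sup>2 + 2 * b\<^sup>2\<close>. This stands in
  for the triangle inequality of the unsquared norm; the factor 2 is harmless for finiteness and for
  convergence to 0.\<close>

lemma nsq_add_le:
  assumes [measurable]: "f \<in> borel_measurable lebesgue" "g \<in> borel_measurable lebesgue"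
  shows "nsq (\<lambda>x. f x + g x) \<le> 2 * nsq f + 2 * nsq g"
proof -
  have "(norm (f x + g x))\<^sup>2 \<le> 2 * (norm (f x))\<^sup>2 + 2 * (norm (g x))\<^sup>2" for x
  proof -
    have "(norm (f x + g x))\<^sup>2 \<le> (norm (f x) + norm (g x))\<^sup>2"
      by (intro power_mono norm_triangle_ineq) auto
    also have "\<dots> \<le> 2 * (norm (f x))\<^sup>2 + 2 * (norm (g x))\<^sup>2"
      using sum_squares_bound[of "norm (f x)" "norm (g x)"] by (simp add: power2_sum)
    finally show ?thesis .
  qed
  then have "nsq (\<lambda>x. f x + g x) \<le> (\<integral>\<^sup>+ x. ennreal (2 * (norm (f x))\<^sup>2 + 2 * (norm (g x))\<^sup>2) \<partial>lebesgue)"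
    unfolding nsq_lebesgue by (intro nn_integral_mono ennreal_leI)
  also have "\<dots> = 2 * nsq f + 2 * nsq g"
    by (simp add: ennreal_mult nn_integral_add nn_integral_cmult nsq_lebesgue)
  finally show ?thesis .
qed

lemma nsq_triangle_le:
  assumes "f \<in> borel_measurable lebesgue" "g \<in> borel_measurable lebesgue" "h \<in> borel_measurable lebesgue"
  shows "nsq (\<lambda>x. f x - h x) \<le> 2 * nsq (\<lambda>x. f x - g x) + 2 * nsq (\<lambda>x. g x - h x)"
  using nsq_add_le[of "\<lambda>x. f x - g x" "\<lambda>x. g x - h x"] assms by simp

lemma nsq_tendsto_0_add:
  assumes m: "\<And>n. f n \<in> borel_measurable lebesgue" "\<And>n. g n \<in> borel_measurable lebesgue"
    and f: "(\<lambda>n. nsq (f n)) \<longlonglongrightarrow> 0" and g: "(\<lambda>n. nsq (g n)) \<longlonglongrightarrow> 0"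
  shows "(\<lambda>n. nsq (\<lambda>x. f n x + g n x)) \<longlonglongrightarrow> 0"
proof (rule tendsto_sandwich[OF _ _ tendsto_const])
  have "(\<lambda>n. 2 * nsq (f n) + 2 * nsq (g n)) \<longlonglongrightarrow> 2 * 0 + 2 * 0"
    by (intro tendsto_add ennreal_tendsto_cmult f g) auto
  then show "(\<lambda>n. 2 * nsq (f n) + 2 * nsq (g n)) \<longlonglongrightarrow> 0" by simp
qed (auto intro!: always_eventually nsq_add_le m)

lemma nsq_eq_0_iff:
  assumes [measurable]: "f \<in> borel_measurable lebesgue"
  shows "nsq f = 0 \<longleftrightarrow> (AE x in lebesgue. f x = 0)"
  by (simp add: nsq_lebesgue nn_integral_0_iff_AE)

section \<open>Integrability of Schwartz functions\<close>

lemma integrable_lborel_inverse_1_plus_square: "integrable lborel (\<lambda>x::real. inverse (1 + x\<^sup>2))"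
proof -
  have "set_integrable lborel (einterval (-\<infinity>) \<infinity>) (\<lambda>x. inverse (1 + x\<^sup>2))"
    by (rule integrable_inverse_1_plus_square)
  then show ?thesis by (simp add: set_integrable_def)
qed

lemma schwartz_continuous: "\<phi> \<in> schwartz \<Longrightarrow> continuous_on UNIV \<phi>"
  unfolding schwartz_def
  by (auto dest!: bspec[of _ _ "[]"] simp: continuous_at_imp_continuous_on differentiable_imp_continuous_within)

lemma schwartz_borel_measurable: "\<phi> \<in> schwartz \<Longrightarrow> \<phi> \<in> borel_measurable borel"
  by (intro borel_measurable_continuous_onI schwartz_continuous)

text \<open>The comparison function \<open>w\<close> is a product of one-variable functions, hence
  integrable coordinate by coordinate. Its inverse is a polynomial of degree
  \<open>2 * DIM('a)\<close>, so boundedness of \<open>\<phi>\<close> against the powers 0 and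
  \<open>2 * DIM('a)\<close> of the norm is enough.\<close>

lemma schwartz_integrable:
  fixes \<phi> :: "'a::euclidean_space \<Rightarrow> complex"
  assumes \<phi>: "\<phi> \<in> schwartz"
  shows "integrable lborel \<phi>"
proof -
  let ?N = "DIM('a)"
  define w where "w x = (\<Prod>b\<in>Basis. inverse (1 + (x \<bullet> b)\<^sup>2))" for x :: 'a
  have w0: "w x > 0" for x by (auto simp: w_def intro!: prod_pos add_pos_nonneg)
  have "\<exists>C. \<forall>x. norm x ^ k * norm (\<phi> x) \<le> C" for k
  proof -
    have "bounded (range (\<lambda>x. norm x ^ k *\<^sub>R \<phi> x))"
      using \<phi> by (auto simp: schwartz_def dest!: bspec[of _ _ "[]"])
    then show ?thesis by (auto simp: bounded_iff)
  qed
  then obtain C where C: "\<And>k x. norm x ^ k * norm (\<phi> x) \<le> C k" by metis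
  have le: "norm (\<phi> x) \<le> 2 ^ ?N * (C 0 + C (2 * ?N)) * w x" for x
  proof -
    have "inverse (w x) = (\<Prod>b\<in>Basis. 1 + (x \<bullet> b)\<^sup>2)"
      by (simp add: w_def prod_inversef[symmetric])
    also have "\<dots> \<le> (\<Prod>b\<in>(Basis::'a set). 1 + (norm x)\<^sup>2)"
      using Basis_le_norm[of _ x] by (intro prod_mono) (auto simp flip: abs_le_square_iff)
    also have "\<dots> = (1 + (norm x)\<^sup>2) ^ ?N" by simp
    also have "\<dots> \<le> 2 ^ ?N * (1 + norm x ^ (2 * ?N))"
    proof (cases "norm x \<le> 1")
      case True
      then have "(norm x)\<^sup>2 \<le> 1" by (simp add: power_le_one)
      then have "(1 + (norm x)\<^sup>2) ^ ?N \<le> 2 ^ ?N * 1" by (simp add: power_mono)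
      also have "\<dots> \<le> 2 ^ ?N * (1 + norm x ^ (2 * ?N))" by (intro mult_left_mono) auto
      finally show ?thesis .
    next
      case False
      then have "1 \<le> (norm x)\<^sup>2" by (simp add: one_le_power)
      then have "(1 + (norm x)\<^sup>2) ^ ?N \<le> (2 * (norm x)\<^sup>2) ^ ?N" by (intro power_mono) auto
      also have "\<dots> \<le> 2 ^ ?N * (1 + norm x ^ (2 * ?N))"
        by (simp add: power_mult_distrib power_mult)
      finally show ?thesis .
    qed
    finally have "norm (\<phi> x) * inverse (w x) \<le> norm (\<phi> x) * (2 ^ ?N * (1 + norm x ^ (2 * ?N)))"
      by (intro mult_left_mono) auto
    also have "\<dots> = 2 ^ ?N * (norm x ^ 0 * norm (\<phi> x) + norm x ^ (2 * ?N) * norm (\<phi> x))"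
      by (simp add: algebra_simps)
    also have "\<dots> \<le> 2 ^ ?N * (C 0 + C (2 * ?N))" by (intro mult_left_mono add_mono C) auto
    finally show ?thesis using w0[of x] by (simp add: field_simps)
  qed
  have "integrable lborel w"
    unfolding w_def
    by (rule integrable_lborel_prod[where f="\<lambda>b r. inverse (1 + r\<^sup>2)"]) (rule integrable_lborel_inverse_1_plus_square)
  then have "integrable lborel (\<lambda>x. 2 ^ ?N * (C 0 + C (2 * ?N)) * w x)" by simp
  then show ?thesis
    by (rule Bochner_Integration.integrable_bound)
      (use schwartz_borel_measurable[OF \<phi>] le in \<open>auto intro: order_trans[OF le abs_ge_self]\<close>)
qed

section \<open>The symplectic transform as a rotated Fourier transform\<close>

lemma exp_eq_cis: "exp (- 2 * complex_of_real pi * \<i> * complex_of_real r) = cis (- (2 * pi) * r)"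
  by (simp add: cis_conv_exp mult.commute mult.left_commute)

text \<open>The symplectic phase is the inner product of \<open>(\<omega>, - x)\<close> with
  \<open>(x', \<omega>')\<close>. Since this rotation preserves Lebesgue measure, contractivity
  carries over from \<open>ft\<close>.\<close>

lemma symplectic_fourier_integral_eq_ft:
  fixes F :: "(real^'n) \<times> (real^'n) \<Rightarrow> complex"
  assumes [measurable]: "F \<in> borel_measurable borel"
  shows "symplectic_fourier_integral F = (\<lambda>z. ft F (snd z, - fst z))"
proof
  fix z :: "(real^'n) \<times> (real^'n)"
  obtain x \<omega> where z: "z = (x, \<omega>)" by force
  have "(\<lambda>z. F z * cis (- (2 * pi) * ((\<omega>, - x) \<bullet> z))) \<in> borel_measurable borel" by measurable
  moreover have "symplectic_fourier_integral F z
      = (\<integral>z. F z * cis (- (2 * pi) * ((\<omega>, - x) \<bullet> z)) \<partial>lebesgue)"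
    by (simp only: z symplectic_fourier_integral_def prod.case exp_eq_cis case_prod_beta'
        inner_prod_def fst_conv snd_conv prod.collapse inner_minus_left diff_conv_add_uminus)
  ultimately show "symplectic_fourier_integral F z = ft F (snd z, - fst z)"
    by (simp add: z ft_def integral_completion)
qed

lemma nn_integral_symplectic_rotation:
  fixes u :: "'a::euclidean_space \<times> 'a \<Rightarrow> ennreal"
  assumes [measurable]: "u \<in> borel_measurable borel"
  shows "(\<integral>\<^sup>+ z. u (snd z, - fst z) \<partial>lborel) = (\<integral>\<^sup>+ z. u z \<partial>lborel)"
proof -
  have [measurable]: "u \<in> borel_measurable (borel \<Otimes>\<^sub>M borel)" by (simp add: borel_prod)
  have "(\<integral>\<^sup>+ z. u (snd z, - fst z) \<partial>(lborel \<Otimes>\<^sub>M lborel)) = (\<integral>\<^sup>+ x. \<integral>\<^sup>+ \<omega>. u (\<omega>, - x) \<partial>lborel \<partial>lborel)"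
    by (subst lborel.nn_integral_fst[symmetric]) auto
  also have "\<dots> = (\<integral>\<^sup>+ \<omega>. \<integral>\<^sup>+ x. u (\<omega>, - x) \<partial>lborel \<partial>lborel)"
    by (rule lborel_pair.Fubini') measurable
  also have "\<dots> = (\<integral>\<^sup>+ \<omega>. \<integral>\<^sup>+ x. u (\<omega>, x) \<partial>lborel \<partial>lborel)"
    using nn_integral_lborel_translate(4)[of "\<lambda>x. u (\<omega>, x)" 0 for \<omega>]
    by (subst nn_integral_cong) simp_all
  also have "\<dots> = (\<integral>\<^sup>+ z. u z \<partial>(lborel \<Otimes>\<^sub>M lborel))"
    by (subst lborel.nn_integral_fst) auto
  finally show ?thesis by (simp add: lborel_prod)
qed

lemma symplectic_fourier_integral_measurable:
  fixes F :: "(real^'n) \<times> (real^'n) \<Rightarrow> complex"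
  assumes [measurable]: "F \<in> borel_measurable borel"
  shows "symplectic_fourier_integral F \<in> borel_measurable borel"
proof -
  have "(\<lambda>z::(real^'n) \<times> (real^'n). (snd z, - fst z)) \<in> borel \<rightarrow>\<^sub>M borel"
    by (intro borel_measurable_continuous_onI continuous_intros)
  then show ?thesis
    unfolding symplectic_fourier_integral_eq_ft[OF assms]
    by (rule measurable_compose) (rule borel_measurable_ft[OF assms])
qed

lemma nsq_symplectic_fourier_integral_le:
  assumes [measurable]: "F \<in> borel_measurable borel"
  shows "nsq (symplectic_fourier_integral F) \<le> nsq F"
proof -
  have "nsq (symplectic_fourier_integral F) = nsq (ft F)"
    unfolding symplectic_fourier_integral_eq_ft[OF assms] nsq_def
    by (rule nn_integral_symplectic_rotation) measurable
  then show ?thesis using nsq_ft_le[OF assms] by simp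
qed

lemma integrable_mult_cis:
  assumes "integrable lborel F"
  shows "integrable lborel (\<lambda>t. F t * cis (- (2 * pi) * (w \<bullet> t)))"
proof (rule Bochner_Integration.integrable_bound[OF assms])
  have [measurable]: "F \<in> borel_measurable borel" using assms by (auto dest: borel_measurable_integrable)
  show "(\<lambda>t. F t * cis (- (2 * pi) * (w \<bullet> t))) \<in> borel_measurable lborel" by measurable
qed (auto simp: norm_mult)

lemma ft_add:
  assumes "integrable lborel F" "integrable lborel G"
  shows "ft (\<lambda>x. F x + G x) = (\<lambda>w. ft F w + ft G w)"
  using assms unfolding ft_def
  by (intro ext) (simp only: distrib_right Bochner_Integration.integral_add integrable_mult_cis)

lemma ft_cmult: "ft (\<lambda>x. c * F x) = (\<lambda>w. c * ft F w)"
  by (simp add: ft_def mult.assoc)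

lemma symplectic_fourier_integral_add:
  assumes "integrable lborel F" "integrable lborel G"
  shows "symplectic_fourier_integral (\<lambda>x. F x + G x)
    = (\<lambda>z. symplectic_fourier_integral F z + symplectic_fourier_integral G z)"
proof -
  have [measurable]: "F \<in> borel_measurable borel" "G \<in> borel_measurable borel"
    using assms by (auto dest: borel_measurable_integrable)
  show ?thesis
    by (simp add: symplectic_fourier_integral_eq_ft ft_add assms)
qed

lemma symplectic_fourier_integral_cmult:
  assumes [measurable]: "F \<in> borel_measurable borel"
  shows "symplectic_fourier_integral (\<lambda>x. c * F x) = (\<lambda>z. c * symplectic_fourier_integral F z)"
  by (simp add: symplectic_fourier_integral_eq_ft ft_cmult)

text \<open>Evaluates the \<open>SOME\<close> in \<open>symplectic_fourier\<close> from a single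
  admissible sequence. \<open>G\<close> shows that a choice exists, so the chosen \<open>H\<close>
  has a sequence \<open>\<psi>\<close> of its own; both sequences tend to \<open>F\<close>, and
  contractivity makes the difference of their transforms tend to 0, which forces
  \<open>G = H\<close> almost everywhere.\<close>

theorem L2_eq_symplectic_fourier:
  assumes F: "F \<in> borel_measurable lebesgue" and G: "G \<in> L2"
    and \<phi>: "\<And>n. \<phi> n \<in> schwartz" "L2_tendsto \<phi> F"
      "L2_tendsto (\<lambda>n. symplectic_fourier_integral (\<phi> n)) G"
  shows "L2_eq (symplectic_fourier F) G"
proof -
  let ?S = symplectic_fourier_integral
  define H where "H = symplectic_fourier F"
  have "\<exists>G. G \<in> L2 \<and> (\<exists>\<phi>. (\<forall>n. \<phi> n \<in> schwartz) \<and> L2_tendsto \<phi> F \<and> L2_tendsto (\<lambda>n. ?S (\<phi> n)) G)"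
    using G \<phi> by blast
  from someI_ex[OF this] obtain \<psi> where H: "H \<in> L2" and \<psi>: "\<And>n. \<psi> n \<in> schwartz" "L2_tendsto \<psi> F"
      "L2_tendsto (\<lambda>n. ?S (\<psi> n)) H"
    unfolding H_def symplectic_fourier_def by blast
  note b = schwartz_borel_measurable[OF \<phi>(1)] schwartz_borel_measurable[OF \<psi>(1)]
  note i = schwartz_integrable[OF \<phi>(1)] schwartz_integrable[OF \<psi>(1)]
  note l = borel_imp_lebesgue_measurable
  note [measurable] = F b[THEN l] b[THEN symplectic_fourier_integral_measurable, THEN l]
  have [measurable]: "G \<in> borel_measurable lebesgue" "H \<in> borel_measurable lebesgue"
    using G H by (auto simp: L2_def)
  have lim: "(\<lambda>n. nsq (\<lambda>x. (\<phi> n x - F x) + (F x - \<psi> n x))) \<longlonglongrightarrow> 0"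
    using \<phi>(2) \<psi>(2) unfolding L2_tendsto_iff_nsq nsq_minus_commute[of "\<psi> _"]
    by (intro nsq_tendsto_0_add) measurable
  have le: "nsq (\<lambda>x. ?S (\<phi> n) x - ?S (\<psi> n) x) \<le> nsq (\<lambda>x. (\<phi> n x - F x) + (F x - \<psi> n x))" for n
  proof -
    have [measurable]: "\<phi> n \<in> borel_measurable borel" "\<psi> n \<in> borel_measurable borel" using b by auto
    have "?S (\<lambda>x. \<phi> n x + (-1) * \<psi> n x) = (\<lambda>x. ?S (\<phi> n) x + (-1) * ?S (\<psi> n) x)"
      using symplectic_fourier_integral_add[OF i(1)[of n], of "\<lambda>x. (-1) * \<psi> n x"]
        symplectic_fourier_integral_cmult[of "\<psi> n" "-1"] i(2)[of n] by simp
    then show ?thesis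
      using nsq_symplectic_fourier_integral_le[of "\<lambda>x. \<phi> n x + (-1) * \<psi> n x"] by simp
  qed
  have d: "(\<lambda>n. nsq (\<lambda>x. ?S (\<phi> n) x - ?S (\<psi> n) x)) \<longlonglongrightarrow> 0"
    by (rule tendsto_sandwich[OF _ _ tendsto_const lim]) (intro always_eventually allI le zero_le)+
  have "(\<lambda>n. nsq (\<lambda>x. (G x - ?S (\<phi> n) x) + ((?S (\<phi> n) x - ?S (\<psi> n) x) + (?S (\<psi> n) x - H x)))) \<longlonglongrightarrow> 0"
    using \<phi>(3) \<psi>(3) d unfolding L2_tendsto_iff_nsq nsq_minus_commute[of "?S (\<phi> _)" G]
    by (intro nsq_tendsto_0_add) measurable
  then have "nsq (\<lambda>x. G x - H x) = 0"
    by (simp add: LIMSEQ_const_iff)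
  then have "AE x in lebesgue. H x = G x"
    by (subst (asm) nsq_eq_0_iff) (auto elim: eventually_mono)
  then show ?thesis using G H by (simp add: L2_eq_def H_def)
qed

section \<open>The ambiguity function\<close>

text \<open>Borel measurability survives composition with continuous maps, which the joint
  measurability in \<open>(t, x)\<close> of \<open>f (t + x /\<^sub>R 2)\<close> relies on. The link
  with \<open>L2\<close> is a change on a null set.\<close>

definition L2b :: "('a::euclidean_space \<Rightarrow> complex) set" where
  "L2b = {f \<in> borel_measurable borel. nsq f < \<infinity>}"

lemma L2bD [dest]: "f \<in> L2b \<Longrightarrow> f \<in> borel_measurable borel" "f \<in> L2b \<Longrightarrow> nsq f < \<infinity>"
  by (auto simp: L2b_def)

lemma L2b_add: "f \<in> L2b \<Longrightarrow> g \<in> L2b \<Longrightarrow> (\<lambda>x. f x + g x) \<in> L2b"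
  using nsq_add_le[of f g]
  by (auto simp: L2b_def borel_imp_lebesgue_measurable ennreal_mult_less_top intro: le_less_trans)

lemma L2b_cmult: "f \<in> L2b \<Longrightarrow> (\<lambda>x. c * f x) \<in> L2b"
  by (auto simp: L2b_def nsq_cmult borel_imp_lebesgue_measurable ennreal_mult_less_top)

lemma L2b_diff: "f \<in> L2b \<Longrightarrow> g \<in> L2b \<Longrightarrow> (\<lambda>x. f x - g x) \<in> L2b"
  using L2b_add[of f "\<lambda>x. (-1) * g x"] L2b_cmult[of g "-1"] by simp

lemma nsq_reflect: "f \<in> borel_measurable borel \<Longrightarrow> nsq (reflect f) = nsq f"
  using nn_integral_lborel_translate(4)[of "\<lambda>x. ennreal ((norm (f x))\<^sup>2)" 0]
  by (simp add: nsq_def reflect_def)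

lemma borel_measurable_reflect [measurable]:
  assumes [measurable]: "f \<in> borel_measurable borel"
  shows "reflect f \<in> borel_measurable borel"
  unfolding reflect_def by measurable

lemma L2b_reflect: "f \<in> L2b \<Longrightarrow> reflect f \<in> L2b"
  by (auto simp: L2b_def nsq_reflect)

text \<open>The ambiguity function at \<open>(x, \<omega>)\<close> is the Fourier transform of this
  function of \<open>t\<close>, taken at \<open>\<omega>\<close>.\<close>

definition slice :: "('a::euclidean_space \<Rightarrow> complex) \<Rightarrow> ('a \<Rightarrow> complex) \<Rightarrow> 'a \<Rightarrow> 'a \<Rightarrow> complex" where
  "slice g f x = (\<lambda>t. f (t + x /\<^sub>R 2) * cnj (g (t - x /\<^sub>R 2)))"

lemma slice_measurable [measurable]:
  assumes [measurable]: "f \<in> borel_measurable borel" "g \<in> borel_measurable borel"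
  shows "slice g f x \<in> borel_measurable borel"
  unfolding slice_def by measurable

lemma ambiguity_eq_ft:
  fixes f g :: "real^'n \<Rightarrow> complex"
  assumes [measurable]: "f \<in> borel_measurable borel" "g \<in> borel_measurable borel"
  shows "ambiguity g f = (\<lambda>(x, \<omega>). ft (slice g f x) \<omega>)"
proof -
  have "(\<integral>t. f (t + x /\<^sub>R 2) * cnj (g (t - x /\<^sub>R 2)) * cis (- (2 * pi) * (\<omega> \<bullet> t)) \<partial>lebesgue)
      = (\<integral>t. f (t + x /\<^sub>R 2) * cnj (g (t - x /\<^sub>R 2)) * cis (- (2 * pi) * (\<omega> \<bullet> t)) \<partial>lborel)"
    for x \<omega> by (rule integral_completion) measurable
  then show ?thesis
    by (simp only: ambiguity_def ft_def slice_def exp_eq_cis)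
qed

lemma ambiguity_measurable:
  fixes f g :: "real^'n \<Rightarrow> complex"
  assumes [measurable]: "f \<in> borel_measurable borel" "g \<in> borel_measurable borel"
  shows "ambiguity g f \<in> borel_measurable borel"
proof -
  have "(\<lambda>z. \<integral>t. f (t + fst z /\<^sub>R 2) * cnj (g (t - fst z /\<^sub>R 2)) * cis (- (2 * pi) * (snd z \<bullet> t)) \<partial>lborel)
      \<in> borel_measurable (borel \<Otimes>\<^sub>M borel)"
    by measurable
  then show ?thesis
    by (simp only: ambiguity_eq_ft[OF assms] ft_def slice_def case_prod_beta' borel_prod)
qed

text \<open>The inequality half of Moyal's identity. For fixed \<open>x\<close> the transform in
  \<open>t\<close> is a contraction; what remains is a double integral over \<open>t\<close> and the
  shift \<open>x\<close>, which factorises after integrating over \<open>x\<close> first.\<close>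

theorem nsq_ambiguity_le:
  fixes f g :: "real^'n \<Rightarrow> complex"
  assumes [measurable]: "f \<in> borel_measurable borel" "g \<in> borel_measurable borel"
  shows "nsq (ambiguity g f) \<le> nsq f * nsq g"
proof -
  have [measurable]: "ambiguity g f \<in> borel_measurable (borel \<Otimes>\<^sub>M borel)"
    using ambiguity_measurable[OF assms] by (simp add: borel_prod)
  let ?a = "\<lambda>f x. ennreal ((norm (f x))\<^sup>2)"
  have "nsq (ambiguity g f) = (\<integral>\<^sup>+ x. \<integral>\<^sup>+ \<omega>. ?a (ambiguity g f) (x, \<omega>) \<partial>lborel \<partial>lborel)"
    unfolding nsq_def lborel_prod[symmetric] by (subst lborel.nn_integral_fst[symmetric]) auto
  also have "\<dots> = (\<integral>\<^sup>+ x. nsq (ft (slice g f x)) \<partial>lborel)"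
    by (simp add: ambiguity_eq_ft[OF assms] nsq_def)
  also have "\<dots> \<le> (\<integral>\<^sup>+ x. nsq (slice g f x) \<partial>lborel)"
    by (intro nn_integral_mono nsq_ft_le) measurable
  also have "\<dots> = (\<integral>\<^sup>+ x. \<integral>\<^sup>+ t. ?a f t * ?a g (t - x) \<partial>lborel \<partial>lborel)"
  proof (intro nn_integral_cong)
    fix x :: "real^'n"
    have "nsq (slice g f x) = (\<integral>\<^sup>+ t. ?a f (t + x /\<^sub>R 2) * ?a g ((t + x /\<^sub>R 2) - x) \<partial>lborel)"
    proof -
      have "t - x /\<^sub>R 2 = (t + x /\<^sub>R 2) - x" for t
        by (simp add: algebra_simps flip: scaleR_2)
      then show ?thesis
        unfolding nsq_def slice_def by (simp only: norm_mult power_mult_distrib ennreal_mult zero_le_power2 complex_mod_cnj)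
    qed
    also have "\<dots> = (\<integral>\<^sup>+ t. ?a f t * ?a g (t - x) \<partial>lborel)"
      by (rule nn_integral_lborel_translate(2)) measurable
    finally show "nsq (slice g f x) = \<dots>" .
  qed
  also have "\<dots> = (\<integral>\<^sup>+ t. \<integral>\<^sup>+ x. ?a f t * ?a g (t - x) \<partial>lborel \<partial>lborel)"
    by (rule lborel_pair.Fubini') measurable
  also have "\<dots> = (\<integral>\<^sup>+ t. ?a f t * (\<integral>\<^sup>+ x. ?a g (t - x) \<partial>lborel) \<partial>lborel)"
    by (simp add: nn_integral_cmult)
  also have "\<dots> = nsq f * nsq g"
    using nn_integral_lborel_translate(4)[of "?a g"] by (simp add: nsq_def nn_integral_multc)
  finally show ?thesis .
qed

text \<open>Integrability of every slice is what makes the ambiguity function additive at every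
  point, not just almost everywhere: with the default value 0 of the integral, additivity could
  fail.\<close>

lemma slice_integrable:
  assumes f: "f \<in> L2b" and g: "g \<in> L2b"
  shows "integrable lborel (slice g f x)"
proof -
  have [measurable]: "f \<in> borel_measurable borel" "g \<in> borel_measurable borel" using f g by auto
  have fin: "(\<integral>\<^sup>+t. ennreal ((norm (f (t + x /\<^sub>R 2)))\<^sup>2) \<partial>lborel) < \<infinity>"
     "(\<integral>\<^sup>+t. ennreal ((norm (g (t - x /\<^sub>R 2)))\<^sup>2) \<partial>lborel) < \<infinity>"
    using f g by (auto simp: L2b_def nsq_def nn_integral_lborel_translate(2)[of "\<lambda>t. ennreal ((norm (f t))\<^sup>2)"]
        nn_integral_lborel_translate(3)[of "\<lambda>t. ennreal ((norm (g t))\<^sup>2)"])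
  then have "integrable lborel (\<lambda>t. (norm (f (t + x /\<^sub>R 2)))\<^sup>2)" "integrable lborel (\<lambda>t. (norm (g (t - x /\<^sub>R 2)))\<^sup>2)"
    by (auto simp: integrable_iff_bounded)
  then have "integrable lborel (\<lambda>t. (norm (f (t + x /\<^sub>R 2)))\<^sup>2 + (norm (g (t - x /\<^sub>R 2)))\<^sup>2)" by simp
  then show ?thesis
  proof (rule Bochner_Integration.integrable_bound)
    have "norm (u * cnj v) \<le> (norm u)\<^sup>2 + (norm v)\<^sup>2" for u v :: complex
    proof -
      have "2 * norm (u * cnj v) \<le> (norm u)\<^sup>2 + (norm v)\<^sup>2"
        using sum_squares_bound[of "norm u" "norm v"] by (simp add: norm_mult)
      then show ?thesis using norm_ge_zero[of "u * cnj v"] by linarith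
    qed
    then show "AE t in lborel. norm (slice g f x t) \<le> norm ((norm (f (t + x /\<^sub>R 2)))\<^sup>2 + (norm (g (t - x /\<^sub>R 2)))\<^sup>2)"
      by (auto simp: slice_def)
  qed measurable
qed

lemma ambiguity_add:
  fixes f1 f2 g :: "real^'n \<Rightarrow> complex"
  assumes "f1 \<in> L2b" "f2 \<in> L2b" "g \<in> L2b"
  shows "ambiguity g (\<lambda>t. f1 t + f2 t) = (\<lambda>z. ambiguity g f1 z + ambiguity g f2 z)"
proof -
  have "slice g (\<lambda>t. f1 t + f2 t) x = (\<lambda>t. slice g f1 x t + slice g f2 x t)" for x
    by (simp add: slice_def distrib_right)
  then show ?thesis
    using assms by (auto simp: ambiguity_eq_ft L2b_add L2bD(1) ft_add slice_integrable)
qed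

lemma ambiguity_add_window:
  fixes f g1 g2 :: "real^'n \<Rightarrow> complex"
  assumes "f \<in> L2b" "g1 \<in> L2b" "g2 \<in> L2b"
  shows "ambiguity (\<lambda>t. g1 t + g2 t) f = (\<lambda>z. ambiguity g1 f z + ambiguity g2 f z)"
proof -
  have "slice (\<lambda>t. g1 t + g2 t) f x = (\<lambda>t. slice g1 f x t + slice g2 f x t)" for x
    by (simp add: slice_def distrib_left)
  then show ?thesis
    using assms by (auto simp: ambiguity_eq_ft L2b_add L2bD(1) ft_add slice_integrable)
qed

lemma ambiguity_cmult: "ambiguity g (\<lambda>t. c * f t) = (\<lambda>z. c * ambiguity g f z)"
  by (auto simp: ambiguity_def mult.assoc)

lemma ambiguity_cmult_window: "ambiguity (\<lambda>t. c * g t) f = (\<lambda>z. cnj c * ambiguity g f z)"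
  by (auto simp: ambiguity_def mult.assoc mult.left_commute)

text \<open>The difference splits into one term with \<open>fn n - f\<close> and window
  \<open>gn n\<close>, and one with \<open>f\<close> and window \<open>gn n - g\<close>; each is
  bounded by \<open>nsq_ambiguity_le\<close>.\<close>

lemma ambiguity_tendsto:
  fixes f g :: "real^'n \<Rightarrow> complex"
  assumes f: "f \<in> L2b" "\<And>n. fn n \<in> L2b" "(\<lambda>n. nsq (\<lambda>t. fn n t - f t)) \<longlonglongrightarrow> 0"
    and g: "g \<in> L2b" "\<And>n. gn n \<in> L2b" "(\<lambda>n. nsq (\<lambda>t. gn n t - g t)) \<longlonglongrightarrow> 0"
  shows "(\<lambda>n. nsq (\<lambda>z. ambiguity (gn n) (fn n) z - ambiguity g f z)) \<longlonglongrightarrow> 0"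
proof -
  let ?a = "\<lambda>n. nsq (\<lambda>t. gn n t - g t)" and ?b = "\<lambda>n. nsq (\<lambda>t. fn n t - f t)"
  \<comment> \<open>Here \<open>nsq (gn n)\<close> has been replaced by its bound
    \<open>2 * ?a n + 2 * nsq g\<close>, so that the limit of every factor is known.\<close>
  let ?B = "\<lambda>n. 2 * (?b n * (2 * ?a n + 2 * nsq g)) + 2 * (nsq f * ?a n)"
  have dg: "(\<lambda>t. gn n t - g t) \<in> L2b" and df: "(\<lambda>t. fn n t - f t) \<in> L2b" for n
    using f g by (auto intro: L2b_diff)
  have le: "nsq (\<lambda>z. ambiguity (gn n) (fn n) z - ambiguity g f z) \<le> ?B n" for n
  proof -
    have "ambiguity (gn n) (fn n) = (\<lambda>z. ambiguity (gn n) (\<lambda>t. fn n t - f t) z + ambiguity (gn n) f z)"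
      using ambiguity_add[OF df[of n] f(1) g(2)] by simp
    moreover have "ambiguity (gn n) f = (\<lambda>z. ambiguity (\<lambda>t. gn n t - g t) f z + ambiguity g f z)"
      using ambiguity_add_window[OF f(1) dg[of n] g(1)] by simp
    ultimately have "(\<lambda>z. ambiguity (gn n) (fn n) z - ambiguity g f z)
        = (\<lambda>z. ambiguity (gn n) (\<lambda>t. fn n t - f t) z + ambiguity (\<lambda>t. gn n t - g t) f z)"
      by (auto simp: fun_eq_iff)
    then have "nsq (\<lambda>z. ambiguity (gn n) (fn n) z - ambiguity g f z)
        \<le> 2 * nsq (ambiguity (gn n) (\<lambda>t. fn n t - f t)) + 2 * nsq (ambiguity (\<lambda>t. gn n t - g t) f)"
      using df dg f g
      by (simp add: nsq_add_le borel_imp_lebesgue_measurable ambiguity_measurable L2bD(1))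
    also have "\<dots> \<le> 2 * (?b n * nsq (gn n)) + 2 * (nsq f * ?a n)"
      using df dg f g
      by (intro add_mono mult_left_mono nsq_ambiguity_le) (auto simp: L2bD(1))
    also have "\<dots> \<le> ?B n"
    proof (intro add_mono mult_left_mono order_refl)
      show "nsq (gn n) \<le> 2 * ?a n + 2 * nsq g"
        using nsq_add_le[of "\<lambda>t. gn n t - g t" g] dg[of n] g(1)
        by (simp add: borel_imp_lebesgue_measurable L2bD(1))
    qed auto
    finally show ?thesis .
  qed
  have "?B \<longlonglongrightarrow> 2 * (0 * (2 * 0 + 2 * nsq g)) + 2 * (nsq f * 0)"
    using f(1) g(1)
    by (intro tendsto_add ennreal_tendsto_cmult tendsto_mult_ennreal tendsto_const f g)
      (auto simp: L2b_def ennreal_mult_eq_top_iff)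
  then have lim: "?B \<longlonglongrightarrow> 0" by simp
  show ?thesis
    by (rule tendsto_sandwich[OF _ _ tendsto_const lim]) (intro always_eventually allI le zero_le)+
qed

lemma dilation_measurable:
  assumes [measurable]: "F \<in> borel_measurable borel"
  shows "dilation \<alpha> F \<in> borel_measurable borel"
proof -
  have "dilation \<alpha> F = (\<lambda>z. F (\<alpha> *\<^sub>R z))" by (auto simp: dilation_def scaleR_prod_def)
  then show ?thesis by simp
qed

lemma nsq_dilation:
  fixes F :: "(real^'n) \<times> (real^'n) \<Rightarrow> complex"
  assumes [measurable]: "F \<in> borel_measurable borel" and "\<alpha> \<noteq> 0"
  shows "nsq (dilation \<alpha> F) = ennreal (\<bar>inverse \<alpha>\<bar> ^ DIM((real^'n) \<times> (real^'n))) * nsq F"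
proof -
  have [measurable]: "dilation \<alpha> F \<in> borel_measurable borel" by (rule dilation_measurable) fact
  have eq: "dilation \<alpha> F = (\<lambda>z. F (\<alpha> *\<^sub>R z))" by (auto simp: dilation_def scaleR_prod_def)
  show ?thesis
    using nn_integral_lborel_affine[of "\<lambda>z. ennreal ((norm (dilation \<alpha> F z))\<^sup>2)" "inverse \<alpha>" 0] assms(2)
    by (simp add: nsq_def eq)
qed

section \<open>Density of Gaussians\<close>

definition gauss :: "real \<Rightarrow> 'a::euclidean_space \<Rightarrow> 'a \<Rightarrow> complex" where
  "gauss a b = (\<lambda>t. complex_of_real (exp (- a * (norm t)\<^sup>2 + b \<bullet> t)))"

inductive_set gspan :: "('a::euclidean_space \<Rightarrow> complex) set" where
  gauss: "a > 0 \<Longrightarrow> gauss a b \<in> gspan"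
| add: "f \<in> gspan \<Longrightarrow> g \<in> gspan \<Longrightarrow> (\<lambda>t. f t + g t) \<in> gspan"
| cmult: "f \<in> gspan \<Longrightarrow> (\<lambda>t. c * f t) \<in> gspan"

lemma gspan_zero: "(\<lambda>_. 0) \<in> gspan"
  using gspan.cmult[OF gspan.gauss[of 1 0], of 0] by simp

lemma gspan_sum: "finite I \<Longrightarrow> (\<And>i. i \<in> I \<Longrightarrow> f i \<in> gspan) \<Longrightarrow> (\<lambda>t. \<Sum>i\<in>I. f i t) \<in> gspan"
  by (induction I rule: finite_induct) (auto intro: gspan.add gspan_zero)

lemma gauss_mult: "gauss a b t * gauss c d t = gauss (a + c) (b + d) t"
  by (simp add: gauss_def inner_add_left algebra_simps flip: of_real_mult exp_add)

lemma gauss_mult_gspan: "f \<in> gspan \<Longrightarrow> a > 0 \<Longrightarrow> (\<lambda>t. gauss a b t * f t) \<in> gspan"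
proof (induction rule: gspan.induct)
  case (gauss c d)
  then show ?case unfolding gauss_mult by (intro gspan.gauss) simp
next
  case (add f g)
  then show ?case unfolding distrib_left by (intro gspan.add) auto
next
  case (cmult f c)
  then show ?case unfolding mult.left_commute[of _ c] by (intro gspan.cmult) auto
qed

text \<open>Completing the square moves the centre to \<open>b /\<^sub>R (2 * a)\<close>.\<close>

lemma gauss_eq_translate:
  assumes "a > 0"
  shows "gauss a b t = complex_of_real (exp ((norm b)\<^sup>2 / (4 * a))) *
    complex_of_real (exp (- a * (norm (t - b /\<^sub>R (2 * a)))\<^sup>2))"
proof -
  have "- a * (norm t)\<^sup>2 + b \<bullet> t = (norm b)\<^sup>2 / (4 * a) - a * (norm (t - b /\<^sub>R (2 * a)))\<^sup>2"
    using assms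
    by (simp add: power2_norm_eq_inner inner_diff_left inner_diff_right inner_commute) (simp add: field_simps)
  then show ?thesis by (simp add: gauss_def flip: exp_add of_real_mult)
qed

lemma gauss_L2b:
  assumes a: "a > 0"
  shows "gauss a (b::'a::euclidean_space) \<in> L2b"
proof -
  have [measurable]: "gauss a b \<in> borel_measurable borel" unfolding gauss_def by measurable
  let ?f = "\<lambda>t. ennreal (exp (- (2 * a) * (norm (t::'a))\<^sup>2))"
  let ?p = "b /\<^sub>R (2 * a)"
  have eq: "(norm (gauss a b t))\<^sup>2 = (exp ((norm b)\<^sup>2 / (4 * a)))\<^sup>2 * exp (- (2 * a) * (norm (t - ?p))\<^sup>2)" for t
    unfolding gauss_eq_translate[OF a] by (simp add: norm_mult power_mult_distrib flip: exp_double)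
  have "nsq (gauss a b) = ennreal ((exp ((norm b)\<^sup>2 / (4 * a)))\<^sup>2) * (\<integral>\<^sup>+ t. ?f (t - ?p) \<partial>lborel)"
    unfolding nsq_def eq by (subst nn_integral_cmult[symmetric]) (auto simp: ennreal_mult)
  also have "(\<integral>\<^sup>+ t. ?f (t - ?p) \<partial>lborel) = (\<integral>\<^sup>+ t. ?f t \<partial>lborel)"
    by (rule nn_integral_lborel_translate(3)) measurable
  finally show ?thesis
    using gaussian_integrable_real[of "2 * a", where 'a='a] a
    by (simp add: L2b_def integrable_iff_bounded ennreal_mult_less_top)
qed

lemma gspan_L2b: "f \<in> gspan \<Longrightarrow> f \<in> L2b"
  by (induction rule: gspan.induct) (auto intro: gauss_L2b L2b_add L2b_cmult)

text \<open>The L2 closure of \<open>gspan\<close> among Borel functions. The rest of the section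
  enlarges the known part of it: continuous functions of compact support, indicators, simple
  functions, and finally all of \<open>L2b\<close>.\<close>

definition gclos :: "('a::euclidean_space \<Rightarrow> complex) set" where
  "gclos = {f \<in> borel_measurable borel. \<forall>e>0. \<exists>p\<in>gspan. nsq (\<lambda>t. f t - p t) < ennreal e}"

lemma gclosI_approx:
  assumes f: "f \<in> borel_measurable borel"
    and "\<And>e. e > 0 \<Longrightarrow> \<exists>h\<in>gclos. nsq (\<lambda>t. f t - h t) < ennreal e"
  shows "f \<in> gclos"
proof -
  have "\<exists>p\<in>gspan. nsq (\<lambda>t. f t - p t) < ennreal e" if e: "e > 0" for e
  proof -
    \<comment> \<open>A quarter, because \<open>nsq_triangle_le\<close> doubles each of the two
      errors.\<close>
    have e4: "e / 4 > 0" using e by simp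
    obtain h where h: "h \<in> gclos" "nsq (\<lambda>t. f t - h t) < ennreal (e / 4)"
      using assms(2)[OF e4] by blast
    then obtain p where p: "p \<in> gspan" "nsq (\<lambda>t. h t - p t) < ennreal (e / 4)"
      using e4 unfolding gclos_def by blast
    have "nsq (\<lambda>t. f t - p t) \<le> 2 * nsq (\<lambda>t. f t - h t) + 2 * nsq (\<lambda>t. h t - p t)"
      using f h(1) gspan_L2b[OF p(1)]
      by (intro nsq_triangle_le borel_imp_lebesgue_measurable) (auto simp: gclos_def)
    also have "\<dots> < 2 * ennreal (e / 4) + 2 * ennreal (e / 4)"
      using h(2) p(2) by (intro add_strict_mono ennreal_mult_strict_left_mono) auto
    also have "\<dots> = ennreal e"
      using e by (simp flip: ennreal_plus ennreal_mult' ennreal_numeral)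
    finally show ?thesis using p(1) by blast
  qed
  then show ?thesis using f by (simp add: gclos_def)
qed

lemma gspan_gclos: "f \<in> gspan \<Longrightarrow> f \<in> gclos"
  by (auto simp: gclos_def nsq_def intro!: bexI[of _ f] dest: gspan_L2b)

lemma gclosI_tendsto:
  assumes f: "f \<in> borel_measurable borel" and h: "\<And>n::nat. h n \<in> gclos"
    and lim: "(\<lambda>n. nsq (\<lambda>t. f t - h n t)) \<longlonglongrightarrow> 0"
  shows "f \<in> gclos"
proof (rule gclosI_approx[OF f])
  fix e :: real assume "e > 0"
  then have "eventually (\<lambda>n. nsq (\<lambda>t. f t - h n t) < ennreal e) sequentially"
    using lim by (intro order_tendstoD) auto
  then show "\<exists>h\<in>gclos. nsq (\<lambda>t. f t - h t) < ennreal e"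
    using h by (auto simp: eventually_sequentially)
qed

lemma gclosE_tendsto:
  assumes "f \<in> gclos"
  obtains p where "\<And>n::nat. p n \<in> gspan" "(\<lambda>n. nsq (\<lambda>t. p n t - f t)) \<longlonglongrightarrow> 0"
proof -
  have "\<exists>p\<in>gspan. nsq (\<lambda>t. f t - p t) < ennreal (inverse (real (Suc n)))" for n
    using assms by (auto simp: gclos_def)
  then obtain p where p: "\<And>n. p n \<in> gspan" "\<And>n. nsq (\<lambda>t. f t - p n t) < ennreal (inverse (real (Suc n)))"
    by metis
  have lim: "(\<lambda>n. ennreal (inverse (real (Suc n)))) \<longlonglongrightarrow> 0"
    using tendsto_ennrealI[OF LIMSEQ_inverse_real_of_nat] by simp
  have "(\<lambda>n. nsq (\<lambda>t. p n t - f t)) \<longlonglongrightarrow> 0"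
    by (rule tendsto_sandwich[OF _ _ tendsto_const lim])
      (use p(2) in \<open>auto simp: nsq_minus_commute[of "p _"] intro!: always_eventually less_imp_le\<close>)
  then show thesis using that p(1) by blast
qed

lemma gclos_add:
  assumes f: "f \<in> gclos" and g: "g \<in> gclos"
  shows "(\<lambda>t. f t + g t) \<in> gclos"
proof -
  have [measurable]: "f \<in> borel_measurable borel" "g \<in> borel_measurable borel"
    using f g by (auto simp: gclos_def)
  obtain p where p: "\<And>n. p n \<in> gspan" "(\<lambda>n. nsq (\<lambda>t. p n t - f t)) \<longlonglongrightarrow> 0"
    using gclosE_tendsto[OF f] by blast
  obtain q where q: "\<And>n. q n \<in> gspan" "(\<lambda>n. nsq (\<lambda>t. q n t - g t)) \<longlonglongrightarrow> 0"
    using gclosE_tendsto[OF g] by blast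
  note pq = L2bD(1)[OF gspan_L2b[OF p(1)]] L2bD(1)[OF gspan_L2b[OF q(1)]]
  show ?thesis
  proof (rule gclosI_tendsto)
    show "(\<lambda>t. p n t + q n t) \<in> gclos" for n by (intro gspan_gclos gspan.add p q)
    have "(\<lambda>n. nsq (\<lambda>t. (f t - p n t) + (g t - q n t))) \<longlonglongrightarrow> 0"
      using p(2) q(2) unfolding nsq_minus_commute[of "p _"] nsq_minus_commute[of "q _"]
      by (intro nsq_tendsto_0_add borel_imp_lebesgue_measurable borel_measurable_diff pq) auto
    then show "(\<lambda>n. nsq (\<lambda>t. f t + g t - (p n t + q n t))) \<longlonglongrightarrow> 0"
      by (simp add: algebra_simps)
  qed measurable
qed

lemma gclos_cmult:
  assumes f: "f \<in> gclos"
  shows "(\<lambda>t. c * f t) \<in> gclos"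
proof -
  have [measurable]: "f \<in> borel_measurable borel" using f by (auto simp: gclos_def)
  obtain p where p: "\<And>n. p n \<in> gspan" "(\<lambda>n. nsq (\<lambda>t. p n t - f t)) \<longlonglongrightarrow> 0"
    using gclosE_tendsto[OF f] by blast
  note pm = L2bD(1)[OF gspan_L2b[OF p(1)]]
  show ?thesis
  proof (rule gclosI_tendsto)
    show "(\<lambda>t. c * p n t) \<in> gclos" for n by (intro gspan_gclos gspan.cmult p)
    have "nsq (\<lambda>t. c * f t - c * p n t) = ennreal ((norm c)\<^sup>2) * nsq (\<lambda>t. p n t - f t)" for n
      unfolding nsq_minus_commute[of "p n"] right_diff_distrib[symmetric] using pm[of n]
      by (intro nsq_cmult borel_imp_lebesgue_measurable) auto
    moreover have "(\<lambda>n. ennreal ((norm c)\<^sup>2) * nsq (\<lambda>t. p n t - f t)) \<longlonglongrightarrow> ennreal ((norm c)\<^sup>2) * 0"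
      by (intro ennreal_tendsto_cmult p) auto
    ultimately show "(\<lambda>n. nsq (\<lambda>t. c * f t - c * p n t)) \<longlonglongrightarrow> 0" by simp
  qed measurable
qed

lemma gclos_sum: "finite I \<Longrightarrow> (\<And>i. i \<in> I \<Longrightarrow> f i \<in> gclos) \<Longrightarrow> (\<lambda>t. \<Sum>i\<in>I. f i t) \<in> gclos"
  by (induction I rule: finite_induct) (auto intro: gclos_add gspan_gclos[OF gspan_zero])

text \<open>
  \<open>gmap\<close> embeds the space into a bounded set in such a way that polynomials of \<open>gmap t\<close> are
  combinations of Gaussians.
\<close>

definition gmap :: "'a::euclidean_space \<Rightarrow> real \<times> 'a" where
  "gmap t = (exp (- (norm t)\<^sup>2), \<Sum>b\<in>Basis. exp (- (norm t)\<^sup>2 + b \<bullet> t) *\<^sub>R b)"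

text \<open>The factor \<open>f\<close> supplies the decay: a nonzero constant polynomial alone is
  not in \<open>gspan\<close>. Leaving \<open>f\<close> arbitrary settles products, since
  \<open>p * q * f\<close> is \<open>p\<close> applied to the member \<open>q * f\<close>.\<close>

lemma real_polynomial_gmap_mult_gspan:
  assumes "real_polynomial_function p" "f \<in> gspan"
  shows "(\<lambda>t. complex_of_real (p (gmap t)) * f t) \<in> gspan"
  using assms
proof (induction arbitrary: f rule: real_polynomial_function.induct)
  case (linear l)
  interpret bounded_linear l by fact
  have "complex_of_real (l (gmap t)) * f t = complex_of_real (l (1, 0)) * (gauss 1 0 t * f t)
     + (\<Sum>b\<in>Basis. complex_of_real (l (0, b)) * (gauss 1 b t * f t))" for t
  proof -
    have "gmap t = exp (- (norm t)\<^sup>2) *\<^sub>R (1, 0) + (\<Sum>b\<in>Basis. exp (- (norm t)\<^sup>2 + b \<bullet> t) *\<^sub>R (0, b))"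
      by (simp add: gmap_def prod_eq_iff fst_sum snd_sum)
    then have "l (gmap t) = exp (- (norm t)\<^sup>2) * l (1, 0) + (\<Sum>b\<in>Basis. exp (- (norm t)\<^sup>2 + b \<bullet> t) * l (0, b))"
      by (simp only: add scale sum real_scaleR_def)
    then show ?thesis
      by (simp add: gauss_def algebra_simps sum_distrib_left)
  qed
  then show ?case
    using linear.prems by (auto intro!: gspan.add gspan.cmult gspan_sum gauss_mult_gspan)
next
  case (const c)
  then show ?case by (rule gspan.cmult)
next
  case (add p q)
  then show ?case unfolding of_real_add distrib_right by (intro gspan.add) auto
next
  case (mult p q)
  then show ?case unfolding of_real_mult mult.assoc by auto
qed

lemma norm_gmap_le: "norm (gmap (t::'a::euclidean_space)) \<le> 1 + DIM('a) * exp 1"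
proof -
  have "exp (- (norm t)\<^sup>2 + b \<bullet> t) \<le> exp 1" if "b \<in> Basis" for b
  proof -
    have "b \<bullet> t \<le> norm t" using Basis_le_norm[OF that, of t] by (simp add: inner_commute)
    moreover have "norm t \<le> 1 + (norm t)\<^sup>2" using sum_squares_bound[of 1 "norm t"] norm_ge_zero[of t]
      unfolding power2_eq_square by linarith
    ultimately show ?thesis by simp
  qed
  then have "norm (\<Sum>b\<in>Basis. exp (- (norm t)\<^sup>2 + b \<bullet> t) *\<^sub>R b) \<le> (\<Sum>b\<in>(Basis::'a set). exp 1)"
    by (intro order_trans[OF norm_sum] sum_mono) simp
  moreover have "norm (exp (- (norm t)\<^sup>2)) \<le> 1" by simp
  ultimately show ?thesis
    unfolding gmap_def by (intro order_trans[OF norm_Pair_le]) (simp add: add_mono)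
qed

text \<open>Stone-Weierstrass on a ball that contains the range of \<open>gmap\<close>. The function
  \<open>h t * exp ((norm t)\<^sup>2)\<close> is written as a continuous function \<open>H\<close>
  of \<open>gmap t\<close>; a polynomial \<open>\<delta>\<close>-close to \<open>H\<close>,
  multiplied by \<open>exp (- (norm t)\<^sup>2)\<close>, lies in \<open>gspan\<close> and differs
  from \<open>h\<close> by at most \<open>\<delta>\<close> times this Gaussian, which is small in
  L2.\<close>

lemma continuous_compact_support_gclos:
  fixes h :: "'a::euclidean_space \<Rightarrow> real"
  assumes h: "continuous_on UNIV h" and R: "\<And>t. norm t > R \<Longrightarrow> h t = 0"
  shows "(\<lambda>t. complex_of_real (h t)) \<in> gclos"
proof -
  define r where "r = max R 0"
  \<comment> \<open>A lower bound on the ball of radius \<open>r + 1\<close> for all the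
    exponentials that occur in \<open>gmap\<close>; truncating at \<open>d\<close> keeps the
    logarithms in \<open>T\<close> continuous on the whole space.\<close>
  define d where "d = exp (- (r + 1)\<^sup>2 - (r + 1))"
  \<comment> \<open>A left inverse of \<open>gmap\<close> on the ball of radius
    \<open>r + 1\<close>: the logarithm of the quotient of two components is
    \<open>b \<bullet> t\<close>.\<close>
  define T where "T y = (\<Sum>b\<in>Basis. (ln (max d (snd y \<bullet> b)) - ln (max d (fst y))) *\<^sub>R b)" for y :: "real \<times> 'a"
  \<comment> \<open>A cutoff in the first component \<open>exp (- (norm t)\<^sup>2)\<close>, equal
    to 1 for \<open>norm t \<le> r\<close> and 0 for \<open>norm t \<ge> r + 1\<close>. It removes
    the points where \<open>T\<close> no longer inverts \<open>gmap\<close>; in the shell between,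
    \<open>h\<close> itself vanishes.\<close>
  define \<theta> where "\<theta> s = max 0 (min 1 ((s - exp (- (r + 1)\<^sup>2)) / (exp (- r\<^sup>2) - exp (- (r + 1)\<^sup>2))))" for s :: real
  define H where "H y = h (T y) * exp ((norm (T y))\<^sup>2) * \<theta> (fst y)" for y
  have r: "r \<ge> 0" "\<And>t. norm t > r \<Longrightarrow> h t = 0" using R by (auto simp: r_def)
  have d0: "d > 0" by (simp add: d_def)
  have e: "exp (- (r + 1)\<^sup>2) < exp (- r\<^sup>2)"
    using r by (simp add: power_strict_mono)
  have H_gmap: "H (gmap t) = h t * exp ((norm t)\<^sup>2)" for t
  proof (cases "norm t \<le> r + 1")
    case True
    have sq: "(norm t)\<^sup>2 \<le> (r + 1)\<^sup>2" using True by (intro power_mono) auto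
    have "exp (- (norm t)\<^sup>2 + b \<bullet> t) \<ge> d" if "b \<in> Basis" for b
      using Basis_le_norm[OF that, of t] True sq unfolding d_def exp_le_cancel_iff inner_commute[of b]
      by linarith
    moreover have "exp (- (norm t)\<^sup>2) \<ge> d" using sq r unfolding d_def exp_le_cancel_iff by linarith
    moreover have "snd (gmap t) \<bullet> b = exp (- (norm t)\<^sup>2 + b \<bullet> t)" if "b \<in> Basis" for b
      using that by (simp add: gmap_def inner_sum_left inner_Basis if_distrib cong: if_cong)
    ultimately have "T (gmap t) = (\<Sum>b\<in>Basis. (t \<bullet> b) *\<^sub>R b)"
      unfolding T_def by (intro sum.cong refl) (simp add: gmap_def max_absorb2 inner_commute)
    then have "T (gmap t) = t" by (simp add: euclidean_representation)
    moreover have "\<theta> (fst (gmap t)) = 1" if "norm t \<le> r"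
    proof -
      have "exp (- r\<^sup>2) \<le> exp (- (norm t)\<^sup>2)" using that by (simp add: power_mono)
      then show ?thesis using e by (simp add: \<theta>_def gmap_def)
    qed
    ultimately show ?thesis using r(2)[of t] by (cases "norm t \<le> r") (auto simp: H_def)
  next
    case False
    then have "(r + 1)\<^sup>2 \<le> (norm t)\<^sup>2" using r by (intro power_mono) auto
    then have "\<theta> (fst (gmap t)) = 0"
      using e by (auto simp: \<theta>_def gmap_def divide_nonpos_pos intro!: max_absorb1 min.coboundedI2)
    then show ?thesis using r(2)[of t] False by (simp add: H_def)
  qed
  have contT: "continuous_on UNIV T"
    unfolding T_def using d0 by (intro continuous_intros) (auto simp: max_def)
  have "continuous_on UNIV H"
    unfolding H_def \<theta>_def
    by (intro continuous_intros contT continuous_on_compose2[OF h contT]) (use e in auto)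
  then have contH: "continuous_on S H" for S by (rule continuous_on_subset) auto
  have [measurable]: "h \<in> borel_measurable borel" by (intro borel_measurable_continuous_onI h)
  show ?thesis
  proof (rule gclosI_approx)
    fix e :: real assume e: "e > 0"
    define C where "C = (\<integral>t. exp (- 2 * (norm (t::'a))\<^sup>2) \<partial>lborel)"
    have C0: "C \<ge> 0" by (simp add: C_def)
    have C: "(\<integral>\<^sup>+t. ennreal (exp (- 2 * (norm (t::'a))\<^sup>2)) \<partial>lborel) = ennreal C"
      unfolding C_def using gaussian_integrable_real[of 2, where 'a='a]
      by (intro nn_integral_eq_integral) auto
    \<comment> \<open>The squared error is at most
      \<open>\<delta>\<^sup>2 * C = e * C / (C + 1)\<close>; adding 1 rules out division by
      0.\<close>
    define \<delta> where "\<delta> = sqrt (e / (C + 1))"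
    have \<delta>: "\<delta> > 0" "\<delta>\<^sup>2 * C < e"
      using e C0 by (auto simp: \<delta>_def field_simps)
    obtain p where p: "real_polynomial_function p"
        "\<And>y. y \<in> cball 0 (1 + DIM('a) * exp 1) \<Longrightarrow> \<bar>H y - p y\<bar> < \<delta>"
      using Stone_Weierstrass_real_polynomial_function[OF compact_cball contH \<delta>(1)] by blast
    let ?q = "\<lambda>t::'a. complex_of_real (p (gmap t)) * gauss 1 0 t"
    have q: "?q \<in> gspan" by (intro real_polynomial_gmap_mult_gspan p gspan.gauss) simp
    have "nsq (\<lambda>t. complex_of_real (h t) - ?q t) \<le> (\<integral>\<^sup>+t. ennreal (\<delta>\<^sup>2) * ennreal (exp (- 2 * (norm (t::'a))\<^sup>2)) \<partial>lborel)"
      unfolding nsq_def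
    proof (intro nn_integral_mono)
      fix t :: 'a
      have "complex_of_real (h t) - ?q t = complex_of_real ((H (gmap t) - p (gmap t)) * exp (- (norm t)\<^sup>2))"
        by (simp add: H_gmap gauss_def left_diff_distrib mult.assoc flip: exp_add of_real_mult)
      then have "(norm (complex_of_real (h t) - ?q t))\<^sup>2 = (\<bar>H (gmap t) - p (gmap t)\<bar>)\<^sup>2 * exp (- 2 * (norm t)\<^sup>2)"
        by (simp only: norm_of_real) (simp add: abs_mult power_mult_distrib flip: exp_double)
      also have "\<dots> \<le> \<delta>\<^sup>2 * exp (- 2 * (norm t)\<^sup>2)"
        using p(2)[of "gmap t"] norm_gmap_le[of t] by (intro mult_right_mono power_mono) auto
      finally show "ennreal ((norm (complex_of_real (h t) - ?q t))\<^sup>2) \<le> ennreal (\<delta>\<^sup>2) * ennreal (exp (- 2 * (norm t)\<^sup>2))"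
        by (simp flip: ennreal_mult)
    qed
    also have "\<dots> = ennreal (\<delta>\<^sup>2 * C)"
      using C C0 by (simp add: nn_integral_cmult ennreal_mult)
    also have "\<dots> < ennreal e" using \<delta> e by (simp add: ennreal_lessI)
    finally show "\<exists>h'\<in>gclos. nsq (\<lambda>t. complex_of_real (h t) - h' t) < ennreal e"
      by (intro bexI[OF _ gspan_gclos[OF q]])
  qed measurable
qed

text \<open>The tent functions \<open>h n\<close> of slope \<open>Suc n\<close> tend to the
  indicator pointwise, because \<open>K\<close> is closed. All of them live in the ball of radius
  \<open>R + 1\<close>, since the slope is at least 1, and dominated convergence applies.\<close>

lemma indicator_compact_gclos:
  fixes K :: "'a::euclidean_space set"
  assumes K: "compact K"
  shows "(\<lambda>t. complex_of_real (indicator K t)) \<in> gclos"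
\<comment> \<open>The empty set is treated apart because \<open>infdist t {}\<close> is 0, which
  would make \<open>h n\<close> constantly 1.\<close>
proof (cases "K = {}")
  case True
  then show ?thesis using gspan_gclos[OF gspan_zero] by simp
next
  case False
  define h where "h n t = max 0 (1 - real (Suc n) * infdist t K)" for n and t :: 'a
  obtain R where R: "\<And>x. x \<in> K \<Longrightarrow> norm x \<le> R"
    using compact_imp_bounded[OF K] by (auto simp: bounded_iff)
  have far: "infdist t K \<ge> 1" if "norm t > R + 1" for t
  proof -
    have "dist t x \<ge> 1" if "x \<in> K" for x
      using R[OF that] \<open>norm t > R + 1\<close> norm_triangle_ineq2[of t x] by (simp add: dist_norm)
    then show ?thesis using False by (auto simp: infdist_notempty intro!: cINF_greatest)
  qed
  have h0: "h n t = 0" if "norm t > R + 1" for n t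
  proof -
    have "1 * 1 \<le> real (Suc n) * infdist t K"
      using far[OF that] by (intro mult_mono) auto
    then show ?thesis by (simp add: h_def)
  qed
  have hb: "0 \<le> h n t" "h n t \<le> 1" for n t
    using infdist_nonneg[of t K] by (auto simp: h_def)
  have cont: "continuous_on UNIV (h n)" for n
    unfolding h_def by (intro continuous_intros)
  have [measurable]: "h n \<in> borel_measurable borel" for n
    by (intro borel_measurable_continuous_onI cont)
  have [measurable]: "cball (0::'a) (R + 1) \<in> sets borel" by (intro borel_closed closed_cball)
  have [measurable]: "K \<in> sets borel" using K by (intro borel_closed compact_imp_closed)
  have lim: "(\<lambda>n. h n t) \<longlonglongrightarrow> indicator K t" for t
  proof (cases "t \<in> K")
    case True
    then show ?thesis by (simp add: h_def)
  next
    case notin: False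
    then have d: "infdist t K > 0"
      using K \<open>K \<noteq> {}\<close> by (simp add: infdist_pos_not_in_closed compact_imp_closed)
    obtain N where N: "inverse (infdist t K) \<le> real N" using real_arch_simple by blast
    have "h n t = 0" if "n \<ge> N" for n
    proof -
      have "inverse (infdist t K) \<le> real (Suc n)" using N that by simp
      then have "1 \<le> real (Suc n) * infdist t K" using d by (simp add: field_simps)
      then show ?thesis by (simp add: h_def)
    qed
    then show ?thesis
      using notin by (auto intro!: tendsto_eventually eventually_sequentiallyI[of N])
  qed
  show ?thesis
  proof (rule gclosI_tendsto)
    show "(\<lambda>t. complex_of_real (h n t)) \<in> gclos" for n
      using h0 by (intro continuous_compact_support_gclos[where R="R + 1"] cont)
    have "(\<lambda>n. \<integral>\<^sup>+t. ennreal ((norm (complex_of_real (indicator K t) - complex_of_real (h n t)))\<^sup>2) \<partial>lborel)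
        \<longlonglongrightarrow> (\<integral>\<^sup>+t. 0 \<partial>(lborel :: 'a measure))"
    proof (rule nn_integral_dominated_convergence[where w="indicator (cball 0 (R + 1))"])
      show "AE t in lborel. ennreal ((norm (complex_of_real (indicator K t) - complex_of_real (h n t)))\<^sup>2)
          \<le> indicator (cball 0 (R + 1)) t" for n
      proof (rule AE_I2)
        fix t
        have "\<bar>indicator K t - h n t\<bar>\<^sup>2 \<le> 1\<^sup>2"
          using hb[of n t] by (intro power_mono) (auto simp: indicator_def)
        moreover have "indicator K t - h n t = 0" if "norm t > R + 1"
          using h0[OF that] R[of t] that by (auto simp: indicator_def)
        moreover have "norm (complex_of_real (indicator K t) - complex_of_real (h n t)) = \<bar>indicator K t - h n t\<bar>"
          by (simp flip: of_real_diff)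
        ultimately show "ennreal ((norm (complex_of_real (indicator K t) - complex_of_real (h n t)))\<^sup>2)
          \<le> indicator (cball 0 (R + 1)) t"
          by (cases "norm t > R + 1") (auto simp: ennreal_le_1 split: split_indicator)
      qed
      show "AE t in lborel. (\<lambda>n. ennreal ((norm (complex_of_real (indicator K t) - complex_of_real (h n t)))\<^sup>2)) \<longlonglongrightarrow> 0"
      proof (rule AE_I2)
        fix t
        have "(\<lambda>n. (norm (complex_of_real (indicator K t) - complex_of_real (h n t)))\<^sup>2)
          \<longlonglongrightarrow> (norm (complex_of_real (indicator K t) - complex_of_real (indicator K t)))\<^sup>2"
          by (intro tendsto_intros lim)
        then show "(\<lambda>n. ennreal ((norm (complex_of_real (indicator K t) - complex_of_real (h n t)))\<^sup>2)) \<longlonglongrightarrow> 0"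
          by (intro tendsto_ennrealI[where x=0, simplified]) simp
      qed
      show "(\<integral>\<^sup>+ t. indicator (cball (0::'a) (R + 1)) t \<partial>lborel) < \<infinity>"
        using emeasure_bounded_finite[of "cball (0::'a) (R + 1)"] by simp
    qed measurable
    then show "(\<lambda>n. nsq (\<lambda>t. complex_of_real (indicator K t) - complex_of_real (h n t))) \<longlonglongrightarrow> 0"
      by (simp add: nsq_def)
  qed measurable
qed

text \<open>Inner regularity provides a closed \<open>T\<close> inside \<open>A\<close>, compact
  because \<open>A\<close> is bounded; the squared L2 distance of the two indicators is the measure
  of \<open>A - T\<close>.\<close>

lemma indicator_bounded_gclos:
  fixes A :: "'a::euclidean_space set"
  assumes A[measurable]: "A \<in> sets borel" and "bounded A"
  shows "(\<lambda>t. complex_of_real (indicator A t)) \<in> gclos"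
proof (rule gclosI_approx)
  fix e :: real assume "e > 0"
  have "A \<in> sets lebesgue" using A by (simp add: sets_completionI_sets)
  then obtain T where T: "closed T" "T \<subseteq> A" "emeasure lebesgue (A - T) < ennreal e"
    using sets_lebesgue_inner_closed[OF _ \<open>e > 0\<close>] by metis
  have [measurable]: "T \<in> sets borel" using T by (simp add: borel_closed)
  have "compact T" using T \<open>bounded A\<close> by (auto simp: compact_eq_bounded_closed bounded_subset)
  have "ennreal ((norm (complex_of_real (indicator A t) - complex_of_real (indicator T t)))\<^sup>2) = indicator (A - T) t" for t
    using T(2) by (auto split: split_indicator)
  then have "nsq (\<lambda>t. complex_of_real (indicator A t) - complex_of_real (indicator T t)) = emeasure lborel (A - T)"
    by (simp add: nsq_def)
  also have "\<dots> < ennreal e" using T(3) by (simp add: emeasure_completion)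
  finally show "\<exists>h\<in>gclos. nsq (\<lambda>t. complex_of_real (indicator A t) - h t) < ennreal e"
    by (intro bexI[OF _ indicator_compact_gclos[OF \<open>compact T\<close>]])
qed measurable

lemma simple_function_gclos:
  fixes s :: "'a::euclidean_space \<Rightarrow> complex"
  assumes s: "simple_function borel s" and R: "\<And>t. norm t > R \<Longrightarrow> s t = 0"
  shows "s \<in> gclos"
proof -
  have fin: "finite (range s)" using simple_functionD(1)[OF s] by simp
  have eq: "s = (\<lambda>t. \<Sum>y\<in>range s. y * complex_of_real (indicator (s -` {y}) t))"
  proof
    fix t
    have "(\<Sum>y\<in>range s. y * complex_of_real (indicator (s -` {y}) t)) = (\<Sum>y\<in>range s. if s t = y then y else 0)"
      by (intro sum.cong) (auto simp: indicator_def)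
    then show "s t = (\<Sum>y\<in>range s. y * complex_of_real (indicator (s -` {y}) t))"
      using fin by simp
  qed
  have "(\<lambda>t. y * complex_of_real (indicator (s -` {y}) t)) \<in> gclos" for y
  \<comment> \<open>The level set of 0 is unbounded, but its term in the sum vanishes.\<close>
  proof (cases "y = 0")
    case True
    then show ?thesis using gspan_gclos[OF gspan_zero] by simp
  next
    case False
    have "s -` {y} \<subseteq> cball 0 R" using R False by (auto simp: not_less[symmetric])
    then have "bounded (s -` {y})" using bounded_cball bounded_subset by blast
    then show ?thesis
      using simple_functionD(2)[OF s, of "{y}"] by (intro gclos_cmult indicator_bounded_gclos) auto
  qed
  then show ?thesis by (subst eq) (intro gclos_sum fin)
qed

text \<open>Simple approximations of \<open>f\<close> are cut off to growing balls, so that their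
  nonzero level sets are bounded, and converge by dominated convergence.\<close>

theorem L2b_subset_gclos:
  fixes f :: "'a::euclidean_space \<Rightarrow> complex"
  assumes f: "f \<in> L2b"
  shows "f \<in> gclos"
proof -
  have [measurable]: "f \<in> borel_measurable borel" using f by auto
  obtain s where s: "\<And>i. simple_function borel (s i)" "\<And>t. (\<lambda>i. s i t) \<longlonglongrightarrow> f t"
      "\<And>i t. norm (s i t) \<le> 2 * norm (f t)"
    using borel_measurable_implies_sequence_metric[of f borel 0] by auto
  define u where "u i t = indicator (cball 0 (real i)) t *\<^sub>R s i t" for i t
  have u: "simple_function borel (u i)" for i
    unfolding u_def by (intro simple_function_scaleR simple_function_indicator s) auto
  then have [measurable]: "u i \<in> borel_measurable borel" for i by (rule borel_measurable_simple_function)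
  have lim: "(\<lambda>i. u i t) \<longlonglongrightarrow> f t" for t
  proof -
    obtain N where "norm t \<le> real N" using real_arch_simple by blast
    then have "eventually (\<lambda>i. s i t = u i t) sequentially"
      by (intro eventually_sequentiallyI[of N]) (auto simp: u_def indicator_def)
    then show ?thesis using s(2) by (rule Lim_transform_eventually[rotated])
  qed
  have ub: "norm (u i t) \<le> 2 * norm (f t)" for i t
    using s(3)[of i t] by (auto simp: u_def indicator_def)
  show ?thesis
  proof (rule gclosI_tendsto)
    show "u i \<in> gclos" for i
      by (rule simple_function_gclos[OF u, where R="real i"]) (simp add: u_def indicator_def)
    have "(\<lambda>i. \<integral>\<^sup>+t. ennreal ((norm (f t - u i t))\<^sup>2) \<partial>lborel) \<longlonglongrightarrow> (\<integral>\<^sup>+t. 0 \<partial>(lborel :: 'a measure))"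
    \<comment> \<open>The approximants are bounded by \<open>2 * norm (f t)\<close>, so the
      difference is at most \<open>3 * norm (f t)\<close>; squaring gives the 9.\<close>
    proof (rule nn_integral_dominated_convergence[where w="\<lambda>t. ennreal (9 * (norm (f t))\<^sup>2)"])
      show "AE t in lborel. ennreal ((norm (f t - u i t))\<^sup>2) \<le> ennreal (9 * (norm (f t))\<^sup>2)" for i
      proof (intro AE_I2 ennreal_leI)
        fix t
        have "norm (f t - u i t) \<le> 3 * norm (f t)"
          using norm_triangle_ineq4[of "f t" "u i t"] ub[of i t] by linarith
        then have "(norm (f t - u i t))\<^sup>2 \<le> (3 * norm (f t))\<^sup>2" by (intro power_mono) auto
        then show "(norm (f t - u i t))\<^sup>2 \<le> 9 * (norm (f t))\<^sup>2" by (simp add: power_mult_distrib)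
      qed
      show "AE t in lborel. (\<lambda>i. ennreal ((norm (f t - u i t))\<^sup>2)) \<longlonglongrightarrow> 0"
      proof (rule AE_I2)
        fix t
        have "(\<lambda>i. (norm (f t - u i t))\<^sup>2) \<longlonglongrightarrow> (norm (f t - f t))\<^sup>2"
          by (intro tendsto_intros lim)
        then show "(\<lambda>i. ennreal ((norm (f t - u i t))\<^sup>2)) \<longlonglongrightarrow> 0"
          by (intro tendsto_ennrealI[where x=0, simplified]) simp
      qed
      show "(\<integral>\<^sup>+ t. ennreal (9 * (norm (f t))\<^sup>2) \<partial>lborel) < \<infinity>"
        using f by (simp add: ennreal_mult nn_integral_cmult L2b_def nsq_def ennreal_mult_less_top)
    qed measurable
    then show "(\<lambda>i. nsq (\<lambda>t. f t - u i t)) \<longlonglongrightarrow> 0" by (simp add: nsq_def)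
  qed measurable
qed

section \<open>Schwartz functions of Gaussian type\<close>

text \<open>One half of \<open>k * r\<^sup>2\<close> absorbs the linear term by completing the
  square; the other half, called \<open>y\<close>, absorbs the power through
  \<open>y ^ m \<le> real m ^ m * exp y\<close>.\<close>

lemma power_mult_exp_neg_square_bounded:
  fixes k K :: real
  assumes k: "k > 0"
  shows "\<exists>C. \<forall>r\<ge>0. r ^ m * exp (- k * r\<^sup>2 + K * r) \<le> C"
proof -
  have pow: "y ^ m \<le> real m ^ m * exp y" if "y \<ge> 0" for y :: real
  proof (cases "m = 0")
    case False
    have "y / real m \<le> exp (y / real m)" using exp_ge_add_one_self[of "y / real m"] by linarith
    then have "y \<le> real m * exp (y / real m)" using False by (simp add: field_simps)
    then have "y ^ m \<le> (real m * exp (y / real m)) ^ m" using that by (intro power_mono)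
    also have "\<dots> = real m ^ m * exp y" using False by (simp add: power_mult_distrib flip: exp_of_nat_mult)
    finally show ?thesis .
  qed (use that in simp)
  show ?thesis
  proof (intro exI allI impI)
    fix r :: real assume r: "r \<ge> 0"
    define y where "y = k / 2 * r\<^sup>2"
    have y: "y \<ge> 0" using k by (simp add: y_def)
    have "y + K\<^sup>2 / (2 * k) - K * r = (k * r - K)\<^sup>2 / (2 * k)"
      using k by (simp add: y_def power2_eq_square field_simps)
    also have "\<dots> \<ge> 0" using k by simp
    finally have "K * r \<le> y + K\<^sup>2 / (2 * k)" by simp
    then have e: "exp (- k * r\<^sup>2 + K * r) \<le> exp (- y) * exp (K\<^sup>2 / (2 * k))"
      by (simp add: y_def flip: exp_add)
    have "r ^ m \<le> 1 + (r\<^sup>2) ^ m"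
    proof (cases "r \<le> 1")
      case True
      then have "r ^ m \<le> 1" using r by (simp add: power_le_one)
      then show ?thesis by (simp add: add_increasing2)
    next
      case False
      then have "r ^ m \<le> r ^ (2 * m)" by (intro power_increasing) auto
      then show ?thesis by (simp add: power_mult)
    qed
    also have "(r\<^sup>2) ^ m = (2 / k) ^ m * y ^ m" using k by (simp add: y_def flip: power_mult_distrib)
    also have "1 + \<dots> \<le> exp y + (2 / k) ^ m * (real m ^ m * exp y)"
      using y k by (intro add_mono mult_left_mono pow) auto
    finally have "r ^ m \<le> (1 + (2 / k) ^ m * real m ^ m) * exp y" by (simp add: algebra_simps)
    then have "r ^ m * exp (- k * r\<^sup>2 + K * r)
        \<le> ((1 + (2 / k) ^ m * real m ^ m) * exp y) * (exp (- y) * exp (K\<^sup>2 / (2 * k)))"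
      using e k by (intro mult_mono) auto
    also have "\<dots> = (1 + (2 / k) ^ m * real m ^ m) * exp (K\<^sup>2 / (2 * k))"
      by (simp add: exp_minus)
    finally show "r ^ m * exp (- k * r\<^sup>2 + K * r) \<le> (1 + (2 / k) ^ m * real m ^ m) * exp (K\<^sup>2 / (2 * k))" .
  qed
qed

text \<open>The values of \<open>B\<close> are complex because the ambiguity function of two
  Gaussians of different widths has an imaginary cross term in its exponent. Multiplication by
  linear forms is included to make the class stable under differentiation.\<close>

inductive_set gclass :: "('a::euclidean_space \<Rightarrow> complex) set" where
  exp: "bounded_bilinear B \<Longrightarrow> bounded_linear L \<Longrightarrow> k > 0 \<Longrightarrow> (\<And>x. Re (B x x) \<le> - k * (norm x)\<^sup>2)
    \<Longrightarrow> (\<lambda>x. exp (B x x + L x)) \<in> gclass"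
| add: "f \<in> gclass \<Longrightarrow> g \<in> gclass \<Longrightarrow> (\<lambda>x. f x + g x) \<in> gclass"
| cmult: "f \<in> gclass \<Longrightarrow> (\<lambda>x. c * f x) \<in> gclass"
| linear: "f \<in> gclass \<Longrightarrow> bounded_linear l \<Longrightarrow> (\<lambda>x. l x * f x) \<in> gclass"

text \<open>The exponent \<open>m\<close> stays arbitrary in the induction, since a linear factor
  costs one more power of the norm.\<close>

lemma gclass_decay:
  "f \<in> gclass \<Longrightarrow> \<exists>C. \<forall>x. norm x ^ m * norm (f x) \<le> C"
proof (induction arbitrary: m rule: gclass.induct)
  case (exp B L k)
  obtain K where K: "\<And>x. norm (L x) \<le> norm x * K"
    using bounded_linear.bounded[OF exp(2)] by blast
  obtain C where C: "\<And>r. r \<ge> 0 \<Longrightarrow> r ^ m * exp (- k * r\<^sup>2 + K * r) \<le> C"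
    using power_mult_exp_neg_square_bounded[OF exp(3)] by blast
  have "norm x ^ m * norm (exp (B x x + L x)) \<le> C" for x
  proof -
    have "Re (B x x + L x) \<le> - k * (norm x)\<^sup>2 + K * norm x"
      using exp(4)[of x] K[of x] complex_Re_le_cmod[of "L x"] by (simp add: mult.commute)
    then have "norm x ^ m * norm (exp (B x x + L x)) \<le> norm x ^ m * exp (- k * (norm x)\<^sup>2 + K * norm x)"
      unfolding norm_exp_eq_Re by (intro mult_left_mono) auto
    then show ?thesis using C[of "norm x"] by simp
  qed
  then show ?case by blast
next
  case (add f g)
  obtain C D where "\<And>x. norm x ^ m * norm (f x) \<le> C" "\<And>x. norm x ^ m * norm (g x) \<le> D"
    using add.IH by meson
  then have "norm x ^ m * norm (f x + g x) \<le> C + D" for x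
  proof -
    have "norm x ^ m * norm (f x + g x) \<le> norm x ^ m * (norm (f x) + norm (g x))"
      by (intro mult_left_mono norm_triangle_ineq) auto
    also have "\<dots> \<le> C + D"
      unfolding distrib_left by (intro add_mono) fact+
    finally show ?thesis .
  qed
  then show ?case by blast
next
  case (cmult f c)
  obtain C where "\<And>x. norm x ^ m * norm (f x) \<le> C" using cmult.IH by meson
  then have "norm x ^ m * norm (c * f x) \<le> norm c * C" for x
    unfolding norm_mult mult.left_commute[of _ "norm c"] by (intro mult_left_mono) auto
  then show ?case by blast
next
  case (linear f l)
  obtain K where K: "\<And>x. norm (l x) \<le> norm x * K"
    using bounded_linear.bounded[OF linear(2)] by blast
  obtain C where C: "\<And>x. norm x ^ Suc m * norm (f x) \<le> C" using linear.IH by meson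
  have "norm x ^ m * norm (l x * f x) \<le> \<bar>K\<bar> * C" for x
  proof -
    have "norm (l x) \<le> norm x * \<bar>K\<bar>"
      using K[of x] mult_left_mono[OF abs_ge_self[of K] norm_ge_zero[of x]] by linarith
    then have "norm x ^ m * norm (l x * f x) \<le> norm x ^ m * ((norm x * \<bar>K\<bar>) * norm (f x))"
      unfolding norm_mult by (intro mult_left_mono mult_right_mono) auto
    also have "\<dots> = \<bar>K\<bar> * (norm x ^ Suc m * norm (f x))" by simp
    also have "\<dots> \<le> \<bar>K\<bar> * C" by (intro mult_left_mono C) auto
    finally show ?thesis .
  qed
  then show ?case by blast
qed

text \<open>In a fixed direction \<open>v\<close>, differentiating the exponential brings down
  \<open>B x v + B v x + L v\<close>, a linear form in \<open>x\<close> plus a constant; the product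
  rule for linear factors gives the same shape.\<close>

lemma gclass_derivative:
  "f \<in> gclass \<Longrightarrow> \<exists>f'. (\<forall>x. (f has_derivative f' x) (at x)) \<and> (\<forall>v. (\<lambda>x. f' x v) \<in> gclass)"
proof (induction rule: gclass.induct)
  case (exp B L k)
  interpret B: bounded_bilinear B by fact
  let ?f = "\<lambda>x. exp (B x x + L x)"
  let ?f' = "\<lambda>x v. (B x v + B v x + L v) * ?f x"
  have q: "((\<lambda>x. B x x + L x) has_derivative (\<lambda>v. B x v + B v x + L v)) (at x)" for x
    by (intro has_derivative_add B.FDERIV bounded_linear_imp_has_derivative has_derivative_ident exp(2))
  have "(?f has_derivative ?f' x) (at x)" for x
    using has_derivative_compose[OF q[of x] DERIV_exp[unfolded has_field_derivative_def]]
    by (simp only: mult.commute)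
  moreover have "(\<lambda>x. ?f' x v) \<in> gclass" for v
  proof -
    have l: "bounded_linear (\<lambda>x. B x v + B v x)"
      by (intro bounded_linear_add B.bounded_linear_left B.bounded_linear_right)
    have e: "?f \<in> gclass" by (rule gclass.exp) fact+
    show ?thesis
      unfolding distrib_right[of _ "L v"] by (rule gclass.add[OF gclass.linear[OF e l] gclass.cmult[OF e]])
  qed
  ultimately show ?case by (intro exI[of _ ?f'] conjI allI)
next
  case (add f g)
  obtain f' g' where "\<And>x. (f has_derivative f' x) (at x)" "\<And>v. (\<lambda>x. f' x v) \<in> gclass"
      "\<And>x. (g has_derivative g' x) (at x)" "\<And>v. (\<lambda>x. g' x v) \<in> gclass"
    using add.IH by metis
  then show ?case
    by (intro exI[of _ "\<lambda>x v. f' x v + g' x v"]) (auto intro: gclass.add has_derivative_add)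
next
  case (cmult f c)
  obtain f' where "\<And>x. (f has_derivative f' x) (at x)" "\<And>v. (\<lambda>x. f' x v) \<in> gclass"
    using cmult.IH by metis
  then show ?case
    by (intro exI[of _ "\<lambda>x v. c * f' x v"]) (auto intro: gclass.cmult has_derivative_mult_right)
next
  case (linear f l)
  obtain f' where f': "\<And>x. (f has_derivative f' x) (at x)" "\<And>v. (\<lambda>x. f' x v) \<in> gclass"
    using linear.IH by metis
  have "((\<lambda>x. l x * f x) has_derivative (\<lambda>v. l x * f' x v + l v * f x)) (at x)" for x
    by (intro has_derivative_mult bounded_linear_imp_has_derivative linear f')
  moreover have "(\<lambda>x. l x * f' x v + l v * f x) \<in> gclass" for v
    by (rule gclass.add[OF gclass.linear[OF f'(2) linear(2)] gclass.cmult[OF linear(1)]])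
  ultimately show ?case
    by (intro exI[of _ "\<lambda>x v. l x * f' x v + l v * f x"] conjI allI)
qed

text \<open>By \<open>gclass_derivative\<close> every iterated partial derivative stays in
  \<open>gclass\<close>, where differentiability and decay are both known.\<close>

theorem gclass_schwartz:
  assumes "f \<in> gclass"
  shows "f \<in> schwartz"
proof -
  have ip: "iter_partial bs f \<in> gclass" for bs
  proof (induction bs)
    case (Cons b bs)
    obtain f' where f': "\<And>x. (iter_partial bs f has_derivative f' x) (at x)" "\<And>v. (\<lambda>x. f' x v) \<in> gclass"
      using gclass_derivative[OF Cons] by metis
    have "iter_partial (b # bs) f = (\<lambda>x. f' x b)"
      using frechet_derivative_at[OF f'(1)] by auto
    then show ?case using f'(2) by simp
  qed (simp add: assms)
  have "iter_partial bs f differentiable (at x)" for bs x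
    using gclass_derivative[OF ip[of bs]] unfolding differentiable_def by blast
  moreover have "bounded (range (\<lambda>x. norm x ^ k *\<^sub>R iter_partial bs f x))" for bs k
    using gclass_decay[OF ip[of bs], of k] by (auto simp: bounded_iff)
  ultimately show ?thesis by (auto simp: schwartz_def)
qed

section \<open>Fourier inversion and ambiguity functions of Gaussians\<close>

lemma integral_lborel_affine:
  fixes f :: "'a::euclidean_space \<Rightarrow> complex"
  assumes [measurable]: "f \<in> borel_measurable borel" and c: "c \<noteq> 0"
  shows "(\<integral>x. f x \<partial>lborel) = complex_of_real (\<bar>c\<bar> ^ DIM('a)) * (\<integral>x. f (t + c *\<^sub>R x) \<partial>lborel)"
  by (subst lborel_affine[OF c, of t])
    (simp add: integral_density integral_distr scaleR_conv_of_real)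

lemma ft_translate:
  fixes h :: "'a::euclidean_space \<Rightarrow> complex"
  assumes [measurable]: "h \<in> borel_measurable borel"
  shows "ft (\<lambda>t. h (t - p)) \<eta> = cis (- (2 * pi) * (\<eta> \<bullet> p)) * ft h \<eta>"
proof -
  have "ft (\<lambda>t. h (t - p)) \<eta> = (\<integral>t. h t * cis (- (2 * pi) * (\<eta> \<bullet> (p + t))) \<partial>lborel)"
    unfolding ft_def by (subst integral_lborel_affine[where c=1 and t=p]) auto
  also have "\<dots> = (\<integral>t. cis (- (2 * pi) * (\<eta> \<bullet> p)) * (h t * cis (- (2 * pi) * (\<eta> \<bullet> t))) \<partial>lborel)"
  proof (intro Bochner_Integration.integral_cong refl)
    fix t
    have "cis (- (2 * pi) * (\<eta> \<bullet> (p + t))) = cis (- (2 * pi) * (\<eta> \<bullet> p)) * cis (- (2 * pi) * (\<eta> \<bullet> t))"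
      by (simp only: inner_add_right distrib_left cis_mult)
    then show "h t * cis (- (2 * pi) * (\<eta> \<bullet> (p + t)))
        = cis (- (2 * pi) * (\<eta> \<bullet> p)) * (h t * cis (- (2 * pi) * (\<eta> \<bullet> t)))"
      by (simp only: mult_ac)
  qed
  finally show ?thesis by (simp add: ft_def)
qed

lemma gauss_measurable [measurable]: "gauss a b \<in> borel_measurable borel"
  unfolding gauss_def by measurable

lemma ft_gauss:
  fixes b :: "'a::euclidean_space"
  assumes a: "a > 0"
  shows "ft (gauss a b) \<eta> = complex_of_real (exp ((norm b)\<^sup>2 / (4 * a))) *
    (cis (- (2 * pi) * (\<eta> \<bullet> (b /\<^sub>R (2 * a)))) *
     complex_of_real (sqrt (pi / a) ^ DIM('a) * exp (- pi\<^sup>2 * (norm \<eta>)\<^sup>2 / a)))"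
  unfolding gauss_eq_translate[OF a, abs_def] ft_cmult
  by (subst ft_translate[where h="\<lambda>t. complex_of_real (exp (- a * (norm t)\<^sup>2))"])
    (simp_all only: gaussian_fourier[OF a], measurable)

text \<open>The transform of a Gaussian is a Gaussian of parameter \<open>pi\<^sup>2 / a\<close>
  times a character, so a second application of \<open>gaussian_fourier\<close> performs the
  inversion; the two normalising constants multiply to 1.\<close>

lemma gauss_inversion:
  fixes b :: "'a::euclidean_space"
  assumes a: "a > 0"
  shows "(\<integral>\<eta>. ft (gauss a b) \<eta> * cis (2 * pi * (\<eta> \<bullet> s)) \<partial>lborel) = gauss a b s"
proof -
  let ?p = "b /\<^sub>R (2 * a)" and ?c = "pi\<^sup>2 / a"
  let ?K = "complex_of_real (exp ((norm b)\<^sup>2 / (4 * a)) * sqrt (pi / a) ^ DIM('a))"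
  have c: "?c > 0" using a by simp
  have "ft (gauss a b) \<eta> * cis (2 * pi * (\<eta> \<bullet> s))
      = ?K * (complex_of_real (exp (- ?c * (norm \<eta>)\<^sup>2)) * cis (- (2 * pi) * ((?p - s) \<bullet> \<eta>)))" for \<eta>
  proof -
    have "cis (- (2 * pi) * ((?p - s) \<bullet> \<eta>)) = cis (- (2 * pi) * (\<eta> \<bullet> ?p)) * cis (2 * pi * (\<eta> \<bullet> s))"
      by (simp only: cis_mult inner_diff_left inner_commute[of \<eta>]) (simp add: algebra_simps)
    then show ?thesis unfolding ft_gauss[OF a] by simp
  qed
  then have "(\<integral>\<eta>. ft (gauss a b) \<eta> * cis (2 * pi * (\<eta> \<bullet> s)) \<partial>lborel)
      = ?K * ft (\<lambda>t. complex_of_real (exp (- ?c * (norm t)\<^sup>2))) (?p - s)"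
    by (simp add: ft_def)
  also have "\<dots> = complex_of_real (exp ((norm b)\<^sup>2 / (4 * a)) * (sqrt (pi / a) * sqrt (pi / ?c)) ^ DIM('a)
      * exp (- pi\<^sup>2 * (norm (?p - s))\<^sup>2 / ?c))"
    unfolding gaussian_fourier[OF c] by (simp add: power_mult_distrib)
  also have "sqrt (pi / a) * sqrt (pi / ?c) = 1"
    using a by (simp add: power2_eq_square flip: real_sqrt_mult)
  also have "- pi\<^sup>2 * (norm (?p - s))\<^sup>2 / ?c = - a * (norm (s - ?p))\<^sup>2"
    using a by (simp add: norm_minus_commute)
  finally show ?thesis unfolding gauss_eq_translate[OF a] by simp
qed

text \<open>For fixed \<open>y\<close> the slice is one Gaussian in \<open>t\<close>, so both its
  transform and its inversion reduce to the case of a single Gaussian.\<close>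

lemma slice_gauss:
  "slice (gauss c d) (gauss a b) y
    = (\<lambda>t. complex_of_real (exp (- (a + c) / 4 * (norm y)\<^sup>2 + (b - d) \<bullet> y / 2)) *
        gauss (a + c) (b + d - (a - c) *\<^sub>R y) t)"
proof
  fix t
  have "(- a * (norm (t + y /\<^sub>R 2))\<^sup>2 + b \<bullet> (t + y /\<^sub>R 2)) + (- c * (norm (t - y /\<^sub>R 2))\<^sup>2 + d \<bullet> (t - y /\<^sub>R 2))
     = (- (a + c) / 4 * (norm y)\<^sup>2 + (b - d) \<bullet> y / 2)
       + (- (a + c) * (norm t)\<^sup>2 + (b + d - (a - c) *\<^sub>R y) \<bullet> t)"
    by (simp add: power2_norm_eq_inner inner_diff_left inner_diff_right inner_add_left inner_add_right
        inner_commute) (simp add: field_simps)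
  then show "slice (gauss c d) (gauss a b) y t = complex_of_real (exp (- (a + c) / 4 * (norm y)\<^sup>2 + (b - d) \<bullet> y / 2)) *
        gauss (a + c) (b + d - (a - c) *\<^sub>R y) t"
    unfolding slice_def gauss_def complex_cnj_complex_of_real of_real_mult[symmetric] exp_add[symmetric]
    by (simp only:)
qed

lemma slice_gauss_inversion:
  fixes b :: "'a::euclidean_space"
  assumes "a > 0" "c > 0"
  shows "(\<integral>\<eta>. ft (slice (gauss c d) (gauss a b) y) \<eta> * cis (2 * pi * (\<eta> \<bullet> s)) \<partial>lborel)
    = slice (gauss c d) (gauss a b) y s"
  using assms gauss_inversion[of "a + c" "b + d - (a - c) *\<^sub>R y" s]
  by (simp add: slice_gauss ft_cmult mult.assoc)

lemma gclass_integrable: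
  assumes "F \<in> gclass"
  shows "integrable lborel F" "F \<in> borel_measurable borel"
  using gclass_schwartz[OF assms] by (auto intro: schwartz_integrable schwartz_borel_measurable)

lemma dilation_ambiguity_eq_ft:
  fixes f g :: "real^'n \<Rightarrow> complex"
  assumes "f \<in> borel_measurable borel" "g \<in> borel_measurable borel"
  shows "dilation \<alpha> (ambiguity g f) = (\<lambda>z. ft (slice g f (\<alpha> *\<^sub>R fst z)) (\<alpha> *\<^sub>R snd z))"
  using assms by (auto simp: dilation_def ambiguity_eq_ft)

text \<open>\<open>ft_gauss\<close> applied to \<open>slice_gauss\<close> gives the ambiguity
  function in closed form; collecting the exponent yields a quadratic form \<open>B\<close> with
  negative definite real part and a linear form \<open>L\<close>.\<close>

lemma dilation_ambiguity_gauss_gclass: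
  fixes b d :: "real^'n"
  assumes a: "a > 0" and c: "c > 0"
  shows "dilation (sqrt 2) (ambiguity (gauss c d) (gauss a b)) \<in> gclass"
proof -
  define m where "m = a + c"
  have m: "m > 0" using a c by (simp add: m_def)
  \<comment> \<open>The transform contributes the growing term
    \<open>(norm \<beta>)\<^sup>2 / (4 * m)\<close>, which reduces the decay rate in
    \<open>x\<close> from \<open>m / 2\<close> by \<open>(a - c)\<^sup>2 / (2 * m)\<close>. It
    remains positive, as \<open>(a + c)\<^sup>2 - (a - c)\<^sup>2 = 4 * a * c\<close>.\<close>
  define k1 k2 where "k1 = 2 * a * c / m" and "k2 = 2 * pi\<^sup>2 / m"
  have k: "k1 > 0" "k2 > 0" using a c m by (auto simp: k1_def k2_def)
  define k3 where "k3 = 2 * pi * (a - c) / m"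
  define u where "u = (sqrt 2 / 2) *\<^sub>R (b - d) - (sqrt 2 * (a - c) / (2 * m)) *\<^sub>R (b + d)"
  define v where "v = - (sqrt 2 * pi / m) *\<^sub>R (b + d)"
  define B :: "(real^'n) \<times> (real^'n) \<Rightarrow> (real^'n) \<times> (real^'n) \<Rightarrow> complex" where
    "B X Y = Complex (- k1 * (fst X \<bullet> fst Y) - k2 * (snd X \<bullet> snd Y)) (k3 * (snd X \<bullet> fst Y))" for X Y
  define L :: "(real^'n) \<times> (real^'n) \<Rightarrow> complex" where
    "L X = Complex (u \<bullet> fst X) (v \<bullet> snd X)" for X
  let ?C = "complex_of_real (sqrt (pi / m) ^ CARD('n) * exp ((norm (b + d))\<^sup>2 / (4 * m)))"
  have "bilinear B"
    unfolding bilinear_def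
    by (auto intro!: linearI simp: complex_eq_iff B_def inner_add_left inner_add_right algebra_simps)
  then have bB: "bounded_bilinear B" by (simp add: bilinear_conv_bounded_bilinear)
  have "linear L"
    by (auto intro!: linearI simp: complex_eq_iff L_def inner_add_right)
  then have bL: "bounded_linear L" by (simp add: linear_conv_bounded_linear)
  have "Re (B X X) \<le> - min k1 k2 * (norm X)\<^sup>2" for X
  proof -
    have "(norm X)\<^sup>2 = (norm (fst X))\<^sup>2 + (norm (snd X))\<^sup>2"
      by (simp add: power2_norm_eq_inner inner_prod_def)
    moreover have "min k1 k2 * (norm (fst X))\<^sup>2 \<le> k1 * (norm (fst X))\<^sup>2"
      "min k1 k2 * (norm (snd X))\<^sup>2 \<le> k2 * (norm (snd X))\<^sup>2"
      by (auto intro: mult_right_mono)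
    ultimately show ?thesis
      by (simp add: B_def distrib_left flip: power2_norm_eq_inner)
  qed
  then have E: "(\<lambda>X. exp (B X X + L X)) \<in> gclass"
    using bB bL k by (intro gclass.exp[where k="min k1 k2"]) auto
  have "dilation (sqrt 2) (ambiguity (gauss c d) (gauss a b)) = (\<lambda>X. ?C * exp (B X X + L X))"
  proof
    fix X :: "(real^'n) \<times> (real^'n)"
    obtain x \<omega> where X: "X = (x, \<omega>)" by force
    define y \<eta> where "y = sqrt 2 *\<^sub>R x" and "\<eta> = sqrt 2 *\<^sub>R \<omega>"
    define \<beta> where "\<beta> = b + d - (a - c) *\<^sub>R y"
    define r where "r = - k1 * (x \<bullet> x) - k2 * (\<omega> \<bullet> \<omega>) + u \<bullet> x"
    define s where "s = k3 * (\<omega> \<bullet> x) + v \<bullet> \<omega>"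
    have s: "- (2 * pi) * (\<eta> \<bullet> (\<beta> /\<^sub>R (2 * m))) = s"
      unfolding s_def \<eta>_def \<beta>_def y_def k3_def v_def using m
      by (simp add: inner_diff_right inner_add_right inner_add_left inner_commute field_simps)
    have sq: "(norm y)\<^sup>2 = 2 * (x \<bullet> x)" "(norm \<eta>)\<^sup>2 = 2 * (\<omega> \<bullet> \<omega>)"
      by (simp_all add: y_def \<eta>_def power_mult_distrib power2_norm_eq_inner)
    have nb: "(norm \<beta>)\<^sup>2 = (norm (b + d))\<^sup>2 - 2 * sqrt 2 * (a - c) * ((b + d) \<bullet> x) + 2 * (a - c)\<^sup>2 * (x \<bullet> x)"
    proof -
      have "(norm \<beta>)\<^sup>2 = (norm (b + d))\<^sup>2 - 2 * (a - c) * ((b + d) \<bullet> y) + (a - c)\<^sup>2 * (norm y)\<^sup>2"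
        unfolding \<beta>_def power2_norm_eq_inner
        by (simp add: inner_diff_left inner_diff_right inner_commute power2_eq_square algebra_simps)
      then show ?thesis unfolding sq by (simp add: y_def)
    qed
    have kk: "k1 = m / 2 - (a - c)\<^sup>2 / (2 * m)"
      using m by (simp add: k1_def field_simps) (simp add: m_def power2_eq_square algebra_simps)
    have r: "(- m / 4 * (norm y)\<^sup>2 + (b - d) \<bullet> y / 2) + (norm \<beta>)\<^sup>2 / (4 * m) + - pi\<^sup>2 * (norm \<eta>)\<^sup>2 / m
      = (norm (b + d))\<^sup>2 / (4 * m) + r"
      unfolding sq nb r_def kk k2_def u_def using m
      by (simp add: y_def inner_add_left inner_diff_left field_simps)
    have "dilation (sqrt 2) (ambiguity (gauss c d) (gauss a b)) X
        = complex_of_real (exp (- m / 4 * (norm y)\<^sup>2 + (b - d) \<bullet> y / 2)) *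
         (complex_of_real (exp ((norm \<beta>)\<^sup>2 / (4 * m))) * (cis s *
         complex_of_real (sqrt (pi / m) ^ CARD('n) * exp (- pi\<^sup>2 * (norm \<eta>)\<^sup>2 / m))))"
    proof -
      have "dilation (sqrt 2) (ambiguity (gauss c d) (gauss a b)) X = ft (slice (gauss c d) (gauss a b) y) \<eta>"
        by (simp add: X dilation_ambiguity_eq_ft y_def \<eta>_def)
      then show ?thesis
        unfolding slice_gauss ft_cmult m_def[symmetric] \<beta>_def[symmetric] ft_gauss[OF m] s by simp
    qed
    also have "\<dots> = complex_of_real (sqrt (pi / m) ^ CARD('n) *
        exp ((- m / 4 * (norm y)\<^sup>2 + (b - d) \<bullet> y / 2) + (norm \<beta>)\<^sup>2 / (4 * m) + - pi\<^sup>2 * (norm \<eta>)\<^sup>2 / m)) * cis s"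
      by (simp only: exp_add of_real_mult mult_ac)
    also have "\<dots> = ?C * (complex_of_real (exp r) * cis s)"
      unfolding r by (simp add: exp_add)
    also have "complex_of_real (exp r) * cis s = exp (B X X + L X)"
      by (simp add: exp_eq_polar B_def L_def X r_def s_def)
    finally show "dilation (sqrt 2) (ambiguity (gauss c d) (gauss a b)) X = ?C * exp (B X X + L X)" .
  qed
  then show ?thesis using E by (simp only: gclass.cmult)
qed

text \<open>Integrating over \<open>\<omega>'\<close> first inverts the inner transform at the point
  \<open>x /\<^sub>R sqrt 2\<close>. The resulting slice, with lag
  \<open>sqrt 2 *\<^sub>R x'\<close>, equals the slice of the reflected window with lag
  \<open>sqrt 2 *\<^sub>R x\<close> at \<open>x' /\<^sub>R sqrt 2\<close>, and the integral over
  \<open>x'\<close> is its Fourier transform.\<close>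

lemma symplectic_fourier_integral_dilation_ambiguity:
  fixes f g :: "real^'n \<Rightarrow> complex"
  assumes [measurable]: "f \<in> borel_measurable borel" "g \<in> borel_measurable borel"
    and int: "integrable lborel (dilation (sqrt 2) (ambiguity g f))"
    and inv: "\<And>y s. (\<integral>\<eta>. ft (slice g f y) \<eta> * cis (2 * pi * (\<eta> \<bullet> s)) \<partial>lborel) = slice g f y s"
  shows "symplectic_fourier_integral (dilation (sqrt 2) (ambiguity g f))
    = dilation (sqrt 2) (ambiguity (reflect g) f)"
proof
  fix z :: "(real^'n) \<times> (real^'n)"
  obtain x \<omega> where z: "z = (x, \<omega>)" by force
  \<comment> \<open>\<open>?c\<close> is the Jacobian of the substitution in the frequency; the
    later substitution \<open>u = x' /\<^sub>R sqrt 2\<close> cancels it.\<close>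
  let ?D = "dilation (sqrt 2) (ambiguity g f)" and ?c = "complex_of_real ((1 / sqrt 2) ^ CARD('n))"
  have D: "?D \<in> borel_measurable borel" using int by (auto dest: borel_measurable_integrable)
  have "symplectic_fourier_integral ?D z = (\<integral>w. ?D w * cis (- (2 * pi) * ((\<omega>, - x) \<bullet> w)) \<partial>(lborel \<Otimes>\<^sub>M lborel))"
    unfolding symplectic_fourier_integral_eq_ft[OF D] by (simp add: z ft_def lborel_prod)
  also have "\<dots> = (\<integral>x'. (\<integral>\<omega>'. ?D (x', \<omega>') * cis (- (2 * pi) * ((\<omega>, - x) \<bullet> (x', \<omega>'))) \<partial>lborel) \<partial>lborel)"
    using integrable_mult_cis[OF int, of "(\<omega>, - x)"]
    by (intro lborel_pair.integral_fst'[symmetric]) (simp only: lborel_prod)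
  also have "\<dots> = (\<integral>x'. ?c * (cis (- (2 * pi) * (\<omega> \<bullet> x')) * slice g f (sqrt 2 *\<^sub>R x') (x /\<^sub>R sqrt 2)) \<partial>lborel)"
  proof (intro Bochner_Integration.integral_cong refl)
    fix x' :: "real^'n"
    let ?h = "slice g f (sqrt 2 *\<^sub>R x')" and ?s = "x /\<^sub>R sqrt 2"
    have "cis (- (2 * pi) * ((\<omega>, - x) \<bullet> (x', \<omega>'))) = cis (- (2 * pi) * (\<omega> \<bullet> x')) *
        cis (2 * pi * ((sqrt 2 *\<^sub>R \<omega>') \<bullet> ?s))" for \<omega>'
      by (simp add: cis_mult inner_commute algebra_simps)
    then have "(\<integral>\<omega>'. ?D (x', \<omega>') * cis (- (2 * pi) * ((\<omega>, - x) \<bullet> (x', \<omega>'))) \<partial>lborel)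
      = cis (- (2 * pi) * (\<omega> \<bullet> x')) * (\<integral>\<omega>'. ft ?h (sqrt 2 *\<^sub>R \<omega>') * cis (2 * pi * ((sqrt 2 *\<^sub>R \<omega>') \<bullet> ?s)) \<partial>lborel)"
      by (simp add: dilation_ambiguity_eq_ft mult.left_commute flip: integral_mult_right_zero del: inner_scaleR_left inner_scaleR_right)
    also have "(\<integral>\<omega>'. ft ?h (sqrt 2 *\<^sub>R \<omega>') * cis (2 * pi * ((sqrt 2 *\<^sub>R \<omega>') \<bullet> ?s)) \<partial>lborel)
      = ?c * (\<integral>\<eta>. ft ?h \<eta> * cis (2 * pi * (\<eta> \<bullet> ?s)) \<partial>lborel)"
      by (subst integral_lborel_affine[where c="sqrt 2" and t=0 and f="\<lambda>\<eta>. ft ?h \<eta> * cis (2 * pi * (\<eta> \<bullet> ?s))"])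
        (simp_all add: power_one_over)
    finally show "(\<integral>\<omega>'. ?D (x', \<omega>') * cis (- (2 * pi) * ((\<omega>, - x) \<bullet> (x', \<omega>'))) \<partial>lborel)
      = ?c * (cis (- (2 * pi) * (\<omega> \<bullet> x')) * ?h ?s)"
      unfolding inv by simp
  qed
  also have "\<dots> = ?c * (\<integral>x'. slice (reflect g) f (sqrt 2 *\<^sub>R x) (0 + (1 / sqrt 2) *\<^sub>R x') *
      cis (- (2 * pi) * ((sqrt 2 *\<^sub>R \<omega>) \<bullet> (0 + (1 / sqrt 2) *\<^sub>R x'))) \<partial>lborel)"
  proof -
    have h: "(sqrt 2 *\<^sub>R v) /\<^sub>R 2 = (1 / sqrt 2) *\<^sub>R v" "v /\<^sub>R sqrt 2 = (1 / sqrt 2) *\<^sub>R v" for v :: "real^'n"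
      by (simp_all add: inverse_eq_divide real_div_sqrt field_simps)
    have p: "(sqrt 2 *\<^sub>R \<omega>) \<bullet> ((1 / sqrt 2) *\<^sub>R x') = \<omega> \<bullet> x'" for x' by simp
    have "slice g f (sqrt 2 *\<^sub>R x') (x /\<^sub>R sqrt 2) = slice (reflect g) f (sqrt 2 *\<^sub>R x) ((1 / sqrt 2) *\<^sub>R x')" for x'
      unfolding slice_def reflect_def h minus_diff_eq by (simp only: add.commute)
    then show ?thesis by (simp only: add_0_left p mult.commute[of "cis _"] integral_mult_right_zero)
  qed
  also have "\<dots> = (\<integral>u. slice (reflect g) f (sqrt 2 *\<^sub>R x) u * cis (- (2 * pi) * ((sqrt 2 *\<^sub>R \<omega>) \<bullet> u)) \<partial>lborel)"
  proof -
    have "\<bar>1 / sqrt 2\<bar> ^ DIM(real^'n) = (1 / sqrt 2) ^ CARD('n)" by simp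
    then show ?thesis
      using integral_lborel_affine[of "\<lambda>u. slice (reflect g) f (sqrt 2 *\<^sub>R x) u * cis (- (2 * pi) * ((sqrt 2 *\<^sub>R \<omega>) \<bullet> u))"
          "1 / sqrt 2" 0]
      by (simp only:) simp
  qed
  also have "\<dots> = dilation (sqrt 2) (ambiguity (reflect g) f) z"
    by (simp add: dilation_ambiguity_eq_ft z ft_def)
  finally show "symplectic_fourier_integral ?D z = dilation (sqrt 2) (ambiguity (reflect g) f) z" .
qed

section \<open>Eigenfunctions of the symplectic Fourier transform\<close>

text \<open>Two nested inductions, over \<open>f\<close> for a Gaussian window and then over
  \<open>g\<close>. Membership in \<open>gclass\<close> is carried along because additivity of the
  transform requires integrability.\<close>

lemma symplectic_fourier_gspan:
  fixes f g :: "real^'n \<Rightarrow> complex"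
  assumes f: "f \<in> gspan" and g: "g \<in> gspan"
  shows "dilation (sqrt 2) (ambiguity g f) \<in> gclass \<and>
    symplectic_fourier_integral (dilation (sqrt 2) (ambiguity g f))
      = dilation (sqrt 2) (ambiguity (reflect g) f)"
proof -
  let ?P = "\<lambda>g f :: real^'n \<Rightarrow> complex. dilation (sqrt 2) (ambiguity g f) \<in> gclass \<and>
    symplectic_fourier_integral (dilation (sqrt 2) (ambiguity g f))
      = dilation (sqrt 2) (ambiguity (reflect g) f)"
  have dil_add: "dilation \<alpha> (\<lambda>z. F z + G z) = (\<lambda>z. dilation \<alpha> F z + dilation \<alpha> G z)"
    and dil_cmult: "dilation \<alpha> (\<lambda>z. c * F z) = (\<lambda>z. c * dilation \<alpha> F z)"
    for \<alpha> c and F G :: "(real^'n) \<times> (real^'n) \<Rightarrow> complex"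
    by (auto simp: dilation_def)
  have reflect_add: "reflect (\<lambda>t. g1 t + g2 t) = (\<lambda>t. reflect g1 t + reflect g2 t)"
    and reflect_cmult: "reflect (\<lambda>t. c * g1 t) = (\<lambda>t. c * reflect g1 t)"
    for c and g1 g2 :: "real^'n \<Rightarrow> complex"
    by (auto simp: reflect_def)
  have "?P (gauss c d) f" if c: "c > 0" for c d
    using f
  proof (induction rule: gspan.induct)
    case (gauss a b)
    have G: "dilation (sqrt 2) (ambiguity (gauss c d) (gauss a b)) \<in> gclass"
      by (rule dilation_ambiguity_gauss_gclass) fact+
    show ?case
      by (intro conjI G symplectic_fourier_integral_dilation_ambiguity gauss_measurable
          gclass_integrable(1)[OF G] slice_gauss_inversion gauss c)
  next
    case (add f1 f2)
    note L = gspan_L2b[OF add(1)] gspan_L2b[OF add(2)] gauss_L2b[OF c, of d]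
    show ?case
      using add.IH
      by (simp add: ambiguity_add L L2b_reflect dil_add gclass.add symplectic_fourier_integral_add
          gclass_integrable)
  next
    case (cmult f1 k)
    then show ?case
      by (simp add: ambiguity_cmult dil_cmult gclass.cmult symplectic_fourier_integral_cmult
          gclass_integrable)
  qed
  note gauss_window = this
  show ?thesis
    using g
  proof (induction rule: gspan.induct)
    case (gauss c d)
    then show ?case by (rule gauss_window)
  next
    case (add g1 g2)
    note L = gspan_L2b[OF add(1)] gspan_L2b[OF add(2)] gspan_L2b[OF f]
    show ?case
      using add.IH
      by (simp add: ambiguity_add_window L L2b_reflect dil_add reflect_add gclass.add
          symplectic_fourier_integral_add gclass_integrable)
  next
    case (cmult g1 k)
    then show ?case
      by (simp add: ambiguity_cmult_window dil_cmult reflect_cmult gclass.cmult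
          symplectic_fourier_integral_cmult gclass_integrable)
  qed
qed

text \<open>The scalar \<open>k\<close> is there for the Wigner distribution, which is a multiple of
  the same function \<open>D\<close>.\<close>

theorem symplectic_fourier_eigenfunction:
  fixes f g :: "real^'n \<Rightarrow> complex"
  assumes f: "f \<in> L2b" and g: "g \<in> L2b"
    and s: "s = 1 \<or> s = -1" and refl: "reflect g = (\<lambda>t. of_real s * g t)"
  defines "D \<equiv> dilation (sqrt 2) (ambiguity g f)"
  shows "L2_eq (symplectic_fourier (\<lambda>z. k * D z)) (\<lambda>z. of_real s * (k * D z))"
proof -
  have ss: "of_real s * of_real s = (1::complex)" using s by auto
  obtain p where p: "\<And>n. p n \<in> gspan" "(\<lambda>n. nsq (\<lambda>t. p n t - f t)) \<longlonglongrightarrow> 0"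
    using gclosE_tendsto[OF L2b_subset_gclos[OF f]] by blast
  obtain q where q: "\<And>n. q n \<in> gspan" "(\<lambda>n. nsq (\<lambda>t. q n t - g t)) \<longlonglongrightarrow> 0"
    using gclosE_tendsto[OF L2b_subset_gclos[OF g]] by blast
  have gspan_reflect: "reflect h \<in> gspan" if "h \<in> gspan" for h :: "real^'n \<Rightarrow> complex"
    using that
  proof (induction rule: gspan.induct)
    case (gauss a b)
    have "reflect (gauss a b) = gauss a (- b)" by (simp add: reflect_def gauss_def algebra_simps)
    then show ?case using gspan.gauss[OF gauss] by simp
  next
    case (add f1 f2)
    then show ?case using gspan.add[OF add.IH] by (simp add: reflect_def)
  next
    case (cmult f1 c)
    then show ?case using gspan.cmult[OF cmult.IH, of c] by (simp add: reflect_def)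
  qed
  \<comment> \<open>Averaging with the signed reflection gives the approximating window the parity
    of \<open>g\<close> exactly, and convergence to \<open>g\<close> persists because
    \<open>g\<close> is its own average.\<close>
  define r where "r n t = (1/2) * (q n t + of_real s * reflect (q n) t)" for n t
  have r: "r n \<in> gspan" for n
    unfolding r_def by (intro gspan.cmult gspan.add gspan_reflect q)
  have reflr: "reflect (r n) = (\<lambda>t. of_real s * r n t)" for n
    using ss by (auto simp: r_def reflect_def algebra_simps mult.assoc[symmetric])
  note [measurable] = L2bD(1)[OF f] L2bD(1)[OF g] L2bD(1)[OF gspan_L2b[OF p(1)]]
    L2bD(1)[OF gspan_L2b[OF q(1)]] L2bD(1)[OF gspan_L2b[OF r]]
  have r_tendsto: "(\<lambda>n. nsq (\<lambda>t. r n t - g t)) \<longlonglongrightarrow> 0"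
  proof -
    have e: "r n t - g t = (1/2) * (q n t - g t) + (of_real s / 2) * reflect (\<lambda>t. q n t - g t) t" for n t
    proof -
      have "of_real s * reflect g t = g t" using ss by (simp add: refl mult.assoc[symmetric])
      then show ?thesis by (simp add: r_def reflect_def algebra_simps)
    qed
    have d: "(\<lambda>t. q n t - g t) \<in> borel_measurable borel" for n by measurable
    have 1: "nsq (\<lambda>t. (1/2) * (q n t - g t)) = ennreal (1/4) * nsq (\<lambda>t. q n t - g t)" for n
      by (subst nsq_cmult) (auto simp: power2_eq_square intro!: borel_imp_lebesgue_measurable d)
    have 2: "nsq (\<lambda>t. (of_real s / 2) * reflect (\<lambda>t. q n t - g t) t) = ennreal (1/4) * nsq (\<lambda>t. q n t - g t)" for n
      using s by (subst nsq_cmult)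
        (auto simp: power2_eq_square nsq_reflect[OF d] intro!: borel_imp_lebesgue_measurable borel_measurable_reflect d)
    have 3: "(\<lambda>n. ennreal (1/4) * nsq (\<lambda>t. q n t - g t)) \<longlonglongrightarrow> 0"
      using ennreal_tendsto_cmult[OF _ q(2), of "ennreal (1/4)"] by simp
    show ?thesis
      unfolding e
      by (intro nsq_tendsto_0_add borel_imp_lebesgue_measurable)
        (simp_all only: 1 2 3, auto intro!: borel_measurable_times borel_measurable_reflect d)
  qed
  define \<phi> where "\<phi> n z = k * dilation (sqrt 2) (ambiguity (r n) (p n)) z" for n z
  have \<phi>: "\<phi> n \<in> schwartz" "symplectic_fourier_integral (\<phi> n) = (\<lambda>z. of_real s * \<phi> n z)" for n
  proof -
    note S = symplectic_fourier_gspan[OF p(1)[of n] r[of n]]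
    then show "\<phi> n \<in> schwartz"
      unfolding \<phi>_def by (intro gclass_schwartz gclass.cmult) auto
    have "dilation (sqrt 2) (ambiguity (reflect (r n)) (p n)) = (\<lambda>z. of_real s * dilation (sqrt 2) (ambiguity (r n) (p n)) z)"
      unfolding reflr ambiguity_cmult_window by (auto simp: dilation_def)
    then show "symplectic_fourier_integral (\<phi> n) = (\<lambda>z. of_real s * \<phi> n z)"
      using S by (simp add: \<phi>_def[abs_def] symplectic_fourier_integral_cmult gclass_integrable mult.left_commute)
  qed
  have A: "ambiguity g f \<in> borel_measurable borel" by (rule ambiguity_measurable) measurable
  have [measurable]: "D \<in> borel_measurable borel"
    unfolding D_def by (rule dilation_measurable[OF A])
  have An: "(\<lambda>z. ambiguity (r n) (p n) z - ambiguity g f z) \<in> borel_measurable borel" for n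
    by (intro borel_measurable_diff ambiguity_measurable) measurable
  let ?C = "ennreal ((norm k)\<^sup>2) * ennreal (\<bar>inverse (sqrt 2)\<bar> ^ DIM((real^'n) \<times> (real^'n)))"
  have eq: "nsq (\<lambda>z. c * (\<phi> n z - k * D z)) = ennreal ((norm c)\<^sup>2) * (?C * nsq (\<lambda>z. ambiguity (r n) (p n) z - ambiguity g f z))" for n c
  proof -
    have e: "(\<lambda>z. c * (\<phi> n z - k * D z)) = (\<lambda>z. (c * k) * dilation (sqrt 2) (\<lambda>z. ambiguity (r n) (p n) z - ambiguity g f z) z)"
      by (auto simp: \<phi>_def D_def dilation_def algebra_simps)
    show ?thesis
      unfolding e
      by (subst nsq_cmult)
        (auto simp: nsq_dilation[OF An] norm_mult power_mult_distrib ennreal_mult mult.assoc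
          intro!: borel_imp_lebesgue_measurable dilation_measurable An)
  qed
  \<comment> \<open>Used with \<open>c = 1\<close> for the approximants and with
    \<open>c = of_real s\<close> for their transforms.\<close>
  have lim: "(\<lambda>n. nsq (\<lambda>z. c * (\<phi> n z - k * D z))) \<longlonglongrightarrow> 0" for c
  proof -
    have "(\<lambda>n. nsq (\<lambda>z. ambiguity (r n) (p n) z - ambiguity g f z)) \<longlonglongrightarrow> 0"
      by (rule ambiguity_tendsto[OF f gspan_L2b[OF p(1)] p(2) g gspan_L2b[OF r] r_tendsto])
    then have "(\<lambda>n. ennreal ((norm c)\<^sup>2) * (?C * nsq (\<lambda>z. ambiguity (r n) (p n) z - ambiguity g f z)))
        \<longlonglongrightarrow> ennreal ((norm c)\<^sup>2) * (?C * 0)"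
      by (intro ennreal_tendsto_cmult) (auto simp: ennreal_mult_less_top)
    then show ?thesis unfolding eq by simp
  qed
  have nD: "nsq D < \<infinity>"
  proof -
    have "nsq (ambiguity g f) \<le> nsq f * nsq g" by (rule nsq_ambiguity_le) measurable
    also have "\<dots> < \<infinity>" using f g by (simp add: L2b_def ennreal_mult_less_top)
    finally show ?thesis unfolding D_def by (subst nsq_dilation[OF A]) (auto simp: ennreal_mult_less_top)
  qed
  show ?thesis
  proof (rule L2_eq_symplectic_fourier[OF _ _ \<phi>(1)])
    show "(\<lambda>z. k * D z) \<in> borel_measurable lebesgue"
      by (rule borel_imp_lebesgue_measurable) measurable
    have "D \<in> L2b" using nD by (simp add: L2b_def)
    then have "(\<lambda>z. of_real s * (k * D z)) \<in> L2b" by (intro L2b_cmult)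
    then show "(\<lambda>z. of_real s * (k * D z)) \<in> L2"
      by (auto simp: L2_iff_nsq borel_imp_lebesgue_measurable)
    show "L2_tendsto \<phi> (\<lambda>z. k * D z)"
      using lim[of 1] by (simp add: L2_tendsto_iff_nsq)
    show "L2_tendsto (\<lambda>n. symplectic_fourier_integral (\<phi> n)) (\<lambda>z. of_real s * (k * D z))"
      using lim[of "of_real s"] by (simp add: L2_tendsto_iff_nsq \<phi>(2) right_diff_distrib)
  qed
qed

section \<open>Borel representatives and the Wigner distribution\<close>

lemma lebesgue_ex_borel_measurable_complex:
  fixes f :: "'a::euclidean_space \<Rightarrow> complex"
  assumes [measurable]: "f \<in> borel_measurable lebesgue"
  shows "\<exists>f'\<in>borel_measurable borel. AE x in lborel. f x = f' x"
proof -
  obtain u where u: "u \<in> borel_measurable lborel" "AE x in lborel. Re (f x) = u x"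
    using completion_ex_borel_measurable_real[of "\<lambda>x. Re (f x)" lborel] by auto
  obtain v where v: "v \<in> borel_measurable lborel" "AE x in lborel. Im (f x) = v x"
    using completion_ex_borel_measurable_real[of "\<lambda>x. Im (f x)" lborel] by auto
  have [measurable]: "u \<in> borel_measurable borel" "v \<in> borel_measurable borel" using u v by auto
  have "AE x in lborel. f x = of_real (u x) + \<i> * of_real (v x)"
    using u(2) v(2) by eventually_elim (simp add: complex_eq_iff)
  moreover have "(\<lambda>x. of_real (u x) + \<i> * of_real (v x)) \<in> borel_measurable borel" by measurable
  ultimately show ?thesis by (intro bexI)
qed

lemma AE_lborel_affine:
  fixes P :: "'a::euclidean_space \<Rightarrow> bool"
  assumes "AE x in lborel. P x" and c: "c \<noteq> 0"
  shows "AE x in lborel. P (t + c *\<^sub>R x)"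
proof -
  obtain N where N: "{x. \<not> P x} \<subseteq> N" "N \<in> sets borel" "emeasure lborel N = 0"
    using AE_E[OF assms(1)] by auto
  note [measurable] = N(2)
  have "ennreal (\<bar>c\<bar> ^ DIM('a)) * (\<integral>\<^sup>+x. indicator N (t + c *\<^sub>R x) \<partial>lborel) = 0"
    using nn_integral_lborel_affine[of "indicator N" c t] N c by simp
  then have "(\<integral>\<^sup>+x. indicator N (t + c *\<^sub>R x) \<partial>lborel) = 0" using c by simp
  then have "AE x in lborel. indicator N (t + c *\<^sub>R x) = (0::ennreal)"
    by (subst (asm) nn_integral_0_iff_AE) measurable
  then show ?thesis by eventually_elim (use N(1) in \<open>auto simp: indicator_def split: if_splits\<close>)
qed

text \<open>Measurability of \<open>F\<close> is inherited from \<open>G\<close> because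
  \<open>lebesgue\<close> is complete.\<close>

lemma integral_lebesgue_cong_AE:
  fixes F G :: "'a::euclidean_space \<Rightarrow> complex"
  assumes ae: "AE x in lborel. F x = G x" and [measurable]: "G \<in> borel_measurable borel"
  shows "(\<integral>x. F x \<partial>lebesgue) = (\<integral>x. G x \<partial>lebesgue)"
proof -
  have G: "G \<in> borel_measurable lebesgue" by (rule borel_imp_lebesgue_measurable) measurable
  have ae': "AE x in lebesgue. F x = G x" using ae by (rule AE_completion)
  then have "AE x in lebesgue. G x = F x" by eventually_elim simp
  then have F: "F \<in> borel_measurable lebesgue" by (rule borel_measurable_AE[OF G])
  show ?thesis by (rule integral_cong_AE[OF F G ae'])
qed

text \<open>Equality holds at every point: for each fixed \<open>x\<close> and
  \<open>\<omega>\<close> the integrands agree for almost every \<open>t\<close>, as translations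
  preserve null sets.\<close>

lemma ambiguity_cong_AE:
  fixes f g f' g' :: "real^'n \<Rightarrow> complex"
  assumes f: "AE t in lborel. f t = f' t" and g: "AE t in lborel. g t = g' t"
    and [measurable]: "f' \<in> borel_measurable borel" "g' \<in> borel_measurable borel"
  shows "ambiguity g f = ambiguity g' f'"
proof -
  have "(\<integral>t. f (t + x /\<^sub>R 2) * cnj (g (t - x /\<^sub>R 2)) * cis (- (2 * pi) * (\<omega> \<bullet> t)) \<partial>lebesgue)
      = (\<integral>t. f' (t + x /\<^sub>R 2) * cnj (g' (t - x /\<^sub>R 2)) * cis (- (2 * pi) * (\<omega> \<bullet> t)) \<partial>lebesgue)" for x \<omega>
  proof (rule integral_lebesgue_cong_AE)
    show "AE t in lborel. f (t + x /\<^sub>R 2) * cnj (g (t - x /\<^sub>R 2)) * cis (- (2 * pi) * (\<omega> \<bullet> t))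
        = f' (t + x /\<^sub>R 2) * cnj (g' (t - x /\<^sub>R 2)) * cis (- (2 * pi) * (\<omega> \<bullet> t))"
      using AE_lborel_affine[OF f, of 1 "x /\<^sub>R 2", simplified] AE_lborel_affine[OF g, of 1 "- (x /\<^sub>R 2)", simplified]
      by eventually_elim (simp add: add.commute)
  qed measurable
  then show ?thesis by (simp only: ambiguity_def exp_eq_cis)
qed

lemma wigner_cong_AE:
  fixes f g f' g' :: "real^'n \<Rightarrow> complex"
  assumes f: "AE t in lborel. f t = f' t" and g: "AE t in lborel. g t = g' t"
    and [measurable]: "f' \<in> borel_measurable borel" "g' \<in> borel_measurable borel"
  shows "wigner g f = wigner g' f'"
proof -
  have "(\<integral>t. f (x + t /\<^sub>R 2) * cnj (g (x - t /\<^sub>R 2)) * cis (- (2 * pi) * (\<omega> \<bullet> t)) \<partial>lebesgue)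
      = (\<integral>t. f' (x + t /\<^sub>R 2) * cnj (g' (x - t /\<^sub>R 2)) * cis (- (2 * pi) * (\<omega> \<bullet> t)) \<partial>lebesgue)" for x \<omega>
  proof (rule integral_lebesgue_cong_AE)
    show "AE t in lborel. f (x + t /\<^sub>R 2) * cnj (g (x - t /\<^sub>R 2)) * cis (- (2 * pi) * (\<omega> \<bullet> t))
        = f' (x + t /\<^sub>R 2) * cnj (g' (x - t /\<^sub>R 2)) * cis (- (2 * pi) * (\<omega> \<bullet> t))"
      using AE_lborel_affine[OF f, of "inverse 2" x, simplified] AE_lborel_affine[OF g, of "- inverse 2" x, simplified]
      by eventually_elim simp
  qed measurable
  then show ?thesis by (simp only: wigner_def exp_eq_cis)
qed

text \<open>The substitution of \<open>2 *\<^sub>R t\<close> for \<open>t\<close> exchanges the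
  roles of centre and lag; it produces the Jacobian and reflects the window.\<close>

lemma wigner_eq_ambiguity:
  fixes f g :: "real^'n \<Rightarrow> complex"
  assumes [measurable]: "f \<in> borel_measurable borel" "g \<in> borel_measurable borel"
  shows "wigner g f = (\<lambda>z. of_real (2 ^ CARD('n)) * dilation 2 (ambiguity (reflect g) f) z)"
proof
  fix z :: "(real^'n) \<times> (real^'n)"
  obtain x \<omega> where z: "z = (x, \<omega>)" by force
  let ?F = "\<lambda>t. f (x + t /\<^sub>R 2) * cnj (g (x - t /\<^sub>R 2)) * cis (- (2 * pi) * (\<omega> \<bullet> t))"
  have "wigner g f z = (\<integral>t. ?F t \<partial>lebesgue)"
    by (simp only: z wigner_def exp_eq_cis prod.case)
  also have "\<dots> = (\<integral>t. ?F t \<partial>lborel)" by (rule integral_completion) measurable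
  also have "\<dots> = of_real (\<bar>2\<bar> ^ DIM(real^'n)) * (\<integral>t. ?F (0 + 2 *\<^sub>R t) \<partial>lborel)"
    by (rule integral_lborel_affine) auto
  also have "(\<integral>t. ?F (0 + 2 *\<^sub>R t) \<partial>lborel) = dilation 2 (ambiguity (reflect g) f) z"
  proof -
    have "?F (0 + 2 *\<^sub>R t) = slice (reflect g) f (2 *\<^sub>R x) t * cis (- (2 * pi) * ((2 *\<^sub>R \<omega>) \<bullet> t))" for t
      by (simp add: slice_def reflect_def add.commute)
    then show ?thesis by (simp only: dilation_ambiguity_eq_ft[OF assms(1) borel_measurable_reflect[OF assms(2)]] ft_def z fst_conv snd_conv)
  qed
  finally show "wigner g f z = of_real (2 ^ CARD('n)) * dilation 2 (ambiguity (reflect g) f) z" by simp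
qed

lemma symplectic_fourier_ambiguity_wigner:
  fixes f g :: "real^'n \<Rightarrow> complex"
  assumes f: "f \<in> L2" and g: "g \<in> L2" and s: "s = 1 \<or> s = -1"
    and refl: "AE t in lebesgue. of_real s * reflect g t = g t"
  shows "L2_eq (symplectic_fourier (dilation (sqrt 2) (ambiguity g f)))
      (\<lambda>z. of_real s * dilation (sqrt 2) (ambiguity g f) z)"
    and "L2_eq (symplectic_fourier (dilation (1 / sqrt 2) (wigner g f)))
      (\<lambda>z. of_real s * dilation (1 / sqrt 2) (wigner g f) z)"
proof -
  have ss: "of_real s * of_real s = (1::complex)" using s by auto
  have rep: "\<exists>h'\<in>L2b. AE t in lborel. h t = h' t" if "h \<in> L2" for h :: "real^'n \<Rightarrow> complex"
  proof -
    obtain h' where h': "h' \<in> borel_measurable borel" "AE t in lborel. h t = h' t"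
      using lebesgue_ex_borel_measurable_complex[of h] \<open>h \<in> L2\<close> by (auto simp: L2_def)
    have "nsq h' = nsq h"
      unfolding nsq_def
    proof (rule nn_integral_cong_AE)
      show "AE t in lborel. ennreal ((norm (h' t))\<^sup>2) = ennreal ((norm (h t))\<^sup>2)"
        using h'(2) by eventually_elim simp
    qed
    then show ?thesis using h' \<open>h \<in> L2\<close> by (auto simp: L2b_def L2_iff_nsq)
  qed
  obtain f' where f': "f' \<in> L2b" "AE t in lborel. f t = f' t" using rep[OF f] by blast
  obtain g0 where g0: "g0 \<in> L2b" "AE t in lborel. g t = g0 t" using rep[OF g] by blast
  \<comment> \<open>The parity of \<open>g\<close> is known only almost everywhere. This average
    satisfies it at every point and still agrees with \<open>g\<close> almost everywhere.\<close>
  define g' where "g' t = (1/2) * (g0 t + of_real s * reflect g0 t)" for t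
  have g'b: "g' \<in> L2b"
    unfolding g'_def[abs_def] by (intro L2b_cmult L2b_add L2b_reflect g0)
  have g'r: "reflect g' = (\<lambda>t. of_real s * g' t)"
    using ss by (auto simp: g'_def reflect_def algebra_simps mult.assoc[symmetric])
  have "AE t in lborel. of_real s * reflect g t = g t" using refl by (simp add: AE_completion_iff)
  moreover have "AE t in lborel. g (- t) = g0 (- t)"
    using AE_lborel_affine[OF g0(2), of "-1" 0] by simp
  ultimately have g'a: "AE t in lborel. g t = g' t"
    using g0(2) by eventually_elim (simp add: g'_def reflect_def)
  have A: "ambiguity g f = ambiguity g' f'"
    using f' g'b by (intro ambiguity_cong_AE g'a) auto
  let ?D = "dilation (sqrt 2) (ambiguity g' f')"
  have W: "dilation (1 / sqrt 2) (wigner g f) = (\<lambda>z. (of_real (2 ^ CARD('n)) * of_real s) * ?D z)"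
  proof -
    have "wigner g f = wigner g' f'"
      using f' g'b by (intro wigner_cong_AE g'a) auto
    also have "\<dots> = (\<lambda>z. of_real (2 ^ CARD('n)) * (of_real s * dilation 2 (ambiguity g' f') z))"
      using f' g'b by (subst wigner_eq_ambiguity) (auto simp: g'r ambiguity_cmult_window dilation_def)
    finally have w: "wigner g f = \<dots>" .
    \<comment> \<open>The dilation by \<open>1 / sqrt 2\<close> meets the factor 2 of
      \<open>wigner_eq_ambiguity\<close>, so the Wigner case lands on the same function
      \<open>?D\<close>.\<close>
    have "2 * (1 / sqrt 2) = sqrt 2" by (simp add: real_div_sqrt)
    then show ?thesis
      unfolding w by (auto simp: dilation_def fun_eq_iff simp del: times_divide_eq_right)
  qed
  note E = symplectic_fourier_eigenfunction[OF f'(1) g'b s g'r]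
  show "L2_eq (symplectic_fourier (dilation (sqrt 2) (ambiguity g f)))
      (\<lambda>z. of_real s * dilation (sqrt 2) (ambiguity g f) z)"
    using E[of 1] by (simp add: A)
  show "L2_eq (symplectic_fourier (dilation (1 / sqrt 2) (wigner g f)))
      (\<lambda>z. of_real s * dilation (1 / sqrt 2) (wigner g f) z)"
    unfolding W by (rule E)
qed

theorem lemma2p9:
  fixes f g :: "real^'n \<Rightarrow> complex"
  assumes "f \<in> L2" and "g \<in> L2"
  shows "(L2_eq (reflect g) g \<longrightarrow>
            L2_eq (symplectic_fourier (dilation (sqrt 2) (ambiguity g f)))
                  (dilation (sqrt 2) (ambiguity g f)) \<and>
            L2_eq (symplectic_fourier (dilation (1 / sqrt 2) (wigner g f)))
                  (dilation (1 / sqrt 2) (wigner g f))) \<and>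
         (L2_eq (\<lambda>t. - reflect g t) g \<longrightarrow>
            L2_eq (symplectic_fourier (dilation (sqrt 2) (ambiguity g f)))
                  (\<lambda>z. - dilation (sqrt 2) (ambiguity g f) z) \<and>
            L2_eq (symplectic_fourier (dilation (1 / sqrt 2) (wigner g f)))
                  (\<lambda>z. - dilation (1 / sqrt 2) (wigner g f) z))"
  using symplectic_fourier_ambiguity_wigner[OF assms, of 1]
    symplectic_fourier_ambiguity_wigner[OF assms, of "-1"]
  by (auto simp: L2_eq_def[of "reflect g"] L2_eq_def[of "\<lambda>t. - reflect g t"])

end
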